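(* Let $\{c_n\}_{n=1}^\infty$ be a sequence of complex numbers with $\lim_{n\to\infty}c_n=0$ and $\sum_{n=1}^\infty |c_n|=\infty$. (1) If $\{c_n\}$ has two distinct ratios, then for any $c\in\mathbb{C}$ the level set $E_c=\{x\in[0,1): \sum_{n=1}^\infty c_nR(2^{n-1}x)=c\}$ satisfies $\dim_H E_c=1$. (2) If $\{c_n\}$ is linearly non-summable and has one ratio, then for any $c\in\mathbb{C}$ and any $\delta>0$, $$\dim_H\Big\{x\in[0,1): \sum_{n=1}^\infty c_nR(2^{n-1}x)\in B(c,\delta)\Big\}=1.$$
   Context: $R:\mathbb{R}\to\{-1,1\}$ is the $1$-periodic function with $R(x)=1$ for $x\in[0,1/2)$ and $R(x)=-1$ for $x\in[1/2,1)$. $\dim_H$ is Hausdorff dimension and $B(c,\delta)$ is the ball in $\mathbb{C}$ with center $c$ and radius $\delta$. Membership of $x$ in each of the sets means that the series $\sum_n c_nR(2^{n-1}x)$ converges to a sum with the stated property. Write $c_n=a_n+ib_n$ with $a_n,b_n\in\mathbb{R}$. The sequence $\{c_n\}$ is linearly non-summable if $c_n\to0$ and $\sum_n|\alpha a_n+\beta b_n|=\infty$ for all $\alpha,\beta\in\mathbb{R}$ with $\alpha+i\beta\ne0$. Let $\{c_n\}\notin\ell^1$ with $c_n\to 0$. An element $t\in\mathbb{R}\cup\{\infty\}$ is called a ratio of $\{c_n\}$ if there is a subsequence $\{c_{n_k}\}_{k=1}^\infty\notin\ell^1$ (i.e. $\sum_k|c_{n_k}|=\infty$) of nonzero terms such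 that $a_{n_k}/b_{n_k}\to t$ as $k\to\infty$. Here $\infty$ is a single unsigned infinity: $a_{n_k}/b_{n_k}\to\infty$ means $|a_{n_k}/b_{n_k}|\to\infty$, with the quotient understood as $\infty$ when $b_{n_k}=0$, $a_{n_k}\ne 0$. "Two distinct ratios" means at least two; "one ratio" means exactly one. *)

theory Defs
  imports "HOL-Analysis.Analysis"
begin

definition R :: "real \<Rightarrow> real" where
  "R x = (if frac x < 1/2 then 1 else - 1)"

(* diam(U)^s with the usual conventions diam({})^s = 0 and diam(U)^0 = 1 for nonempty U;
   the case distinction is needed because 0 powr 0 = 0. *)
definition diam_pow :: "real \<Rightarrow> 'a::metric_space set \<Rightarrow> ennreal" where
  "diam_pow s U = (if U = {} then 0 else if s = 0 then 1 else ennreal (diameter U powr s))"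

(* Boundedness is required explicitly since diameter is unspecified on unbounded sets.
   Finite covers are included by padding with empty sets. *)
definition hausdorff_premeasure :: "real \<Rightarrow> real \<Rightarrow> 'a::metric_space set \<Rightarrow> ennreal" where
  "hausdorff_premeasure s d A =
     (INF U \<in> {U :: nat \<Rightarrow> 'a set. A \<subseteq> (\<Union>i. U i) \<and> (\<forall>i. bounded (U i) \<and> diameter (U i) \<le> d)}.
        \<Sum>i. diam_pow s (U i))"

definition hausdorff_measure :: "real \<Rightarrow> 'a::metric_space set \<Rightarrow> ennreal" where
  "hausdorff_measure s A = (SUP d \<in> {0<..}. hausdorff_premeasure s d A)"

definition hausdorff_dim :: "'a::metric_space set \<Rightarrow> ennreal" where
  "hausdorff_dim A = Inf {ennreal s | s. 0 \<le> s \<and> hausdorff_measure s A = 0}"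

(* Sequences are indexed from 0 throughout: c n stands for the term usually written c_(n+1). *)

definition linearly_nonsummable :: "(nat \<Rightarrow> complex) \<Rightarrow> bool" where
  "linearly_nonsummable c \<longleftrightarrow> c \<longlonglongrightarrow> 0 \<and>
     (\<forall>\<alpha> \<beta> :: real. Complex \<alpha> \<beta> \<noteq> 0 \<longrightarrow> \<not> summable (\<lambda>n. \<bar>\<alpha> * Re (c n) + \<beta> * Im (c n)\<bar>))"

(* The real line with one unsigned point at infinity. *)
datatype proj_real = Finite real | Infty

(* Only meant for z \<noteq> 0. *)
definition quot :: "complex \<Rightarrow> proj_real" where
  "quot z = (if Im z = 0 then Infty else Finite (Re z / Im z))"

fun proj_tendsto :: "(nat \<Rightarrow> proj_real) \<Rightarrow> proj_real \<Rightarrow> bool" where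
  "proj_tendsto q (Finite t) \<longleftrightarrow>
     (\<forall>e>0. eventually (\<lambda>k. \<exists>s. q k = Finite s \<and> \<bar>s - t\<bar> < e) sequentially)"
| "proj_tendsto q Infty \<longleftrightarrow>
     (\<forall>M. eventually (\<lambda>k. \<forall>s. q k = Finite s \<longrightarrow> \<bar>s\<bar> > M) sequentially)"

definition is_ratio :: "(nat \<Rightarrow> complex) \<Rightarrow> proj_real \<Rightarrow> bool" where
  "is_ratio c t \<longleftrightarrow>
     (\<exists>r :: nat \<Rightarrow> nat. strict_mono r \<and> (\<forall>k. c (r k) \<noteq> 0) \<and>
        \<not> summable (\<lambda>k. norm (c (r k))) \<and> proj_tendsto (\<lambda>k. quot (c (r k))) t)"

end

theory Submission
  imports Defs
begin

text \<open>
  Up to the coding of binary digits, a point \<open>x\<close> is a sequence of signs, and the question is how many sign sequences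
  \<open>\<epsilon>\<close> make the series of terms \<open>\<epsilon> n * c n\<close> converge to a prescribed value, or near it. The proof has two halves.

  The first half concerns existence (\<open>exact_sign_sum\<close>, \<open>dense_sign_sums\<close>). Its tool is a rounding lemma in the plane,
  \<open>sign_rounding\<close>: weights in $[-1,1]$ can be replaced by signs so that all partial sums change by at most four times
  the size of the terms. It remains to reach a given vector by a combination with weights in $[-1,1]$, which is a question
  about convex sets and is decided by separating hyperplanes (\<open>fractional_combination\<close>). If the terms are not absolutely
  summable against any functional, every vector can be reached, and rounding gives sums arbitrarily near it. If, in
  addition, every functional is comparable to the length on a set of terms of infinite total length, a vector is reached at a
  cost proportional to its length, and the remaining error can be corrected again and again; in the limit the sum is exact.
  Two distinct ratios imply this stronger condition (\<open>independent_normals_cone\<close>).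

  The second half shows that there is almost complete freedom in the choice (\<open>hausdorff_dim_sign_series\<close>). The
  indices are cut into blocks of a large length \<open>L\<close>. In each block two control terms keep signs of their own, and all other
  terms share one undetermined sign; up to this sign all but two of their digits are prescribed arbitrarily. With the common
  sign still open, the sum of these other terms is a single new term; the new terms tend to $0$, and together with the
  control terms they form a sequence to which the first half applies.
  The positions of the control terms are two residue classes modulo \<open>L\<close> along which the non-summability persists:
  for a non-summable sequence of nonnegative numbers some residue class is non-summable. As the signs of the new
  sequence are chosen after all free digits, convergence of its terms to $0$ is all the control required of them. Reading off the free
  digits maps the resulting set of points onto the half-open unit interval, and \<open>L - 4\<close> out of \<open>L\<close> digits survive; by
  \<open>hausdorff_measure_pos_of_coding\<close> its dimension is at least \<open>(L - 4) / L\<close>.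
\<close>

section \<open>Rounding fractional weights to signs\<close>

definition sign_seq :: "(nat \<Rightarrow> real) \<Rightarrow> bool" where
  "sign_seq \<epsilon> \<longleftrightarrow> (\<forall>n. \<epsilon> n \<in> {-1, 1})"

lemma complex_linear_dependence:
  fixes p q v :: complex
  obtains a b c :: real
  where "(a, b, c) \<noteq> (0, 0, 0)" "a *\<^sub>R p + b *\<^sub>R q + c *\<^sub>R v = 0"
proof (cases "Re p * Im q = Im p * Re q")
  case False
  let ?a = "Re q * Im v - Im q * Re v"
  let ?b = "Re v * Im p - Im v * Re p"
  let ?c = "Re p * Im q - Im p * Re q"
  have "?a *\<^sub>R p + ?b *\<^sub>R q + ?c *\<^sub>R v = 0"
    by (simp add: complex_eq_iff algebra_simps)
  with False that[of ?a ?b ?c] show thesis by auto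
next
  case parallel: True
  show thesis
  proof (cases "p = 0")
    case True
    then show thesis using that[of 1 0 0] by simp
  next
    case False
    have "Re p * Re p * Im q = Re p * (Im p * Re q)" "Im p * Re p * Im q = Im p * (Im p * Re q)"
      using parallel by (simp_all add: mult.commute mult.left_commute)
    then have "(Re p * Re q + Im p * Im q) *\<^sub>R p + (- (Re p * Re p + Im p * Im p)) *\<^sub>R q + 0 *\<^sub>R v = 0"
      using parallel by (simp add: complex_eq_iff algebra_simps)
    moreover have "Re p * Re p + Im p * Im p \<noteq> 0"
      using False by (simp add: complex_eq_iff sum_squares_eq_zero_iff)
    ultimately show thesis
      by (intro that[of "Re p * Re q + Im p * Im q" "- (Re p * Re p + Im p * Im p)" 0])
        (simp_all only: prod.inject neg_equal_0_iff_equal, blast)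
  qed
qed

text \<open>
  Three plane vectors are linearly dependent, so the weights can be moved along a line without changing
  the weighted sum. The largest weight in absolute value is at most $1$ at the start and grows without bound along the
  line; by the intermediate value theorem it equals $1$ somewhere.
\<close>
lemma move_weight_to_boundary:
  fixes p q v :: complex and s r t :: real
  assumes "\<bar>s\<bar> \<le> 1" "\<bar>r\<bar> \<le> 1" "\<bar>t\<bar> \<le> 1"
  obtains s' r' t' where "\<bar>s'\<bar> \<le> 1" "\<bar>r'\<bar> \<le> 1" "\<bar>t'\<bar> \<le> 1"
    "s' *\<^sub>R p + r' *\<^sub>R q + t' *\<^sub>R v = s *\<^sub>R p + r *\<^sub>R q + t *\<^sub>R v"
    "\<bar>s'\<bar> = 1 \<or> \<bar>r'\<bar> = 1 \<or> \<bar>t'\<bar> = 1"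
proof -
  obtain a b c where abc: "(a, b, c) \<noteq> (0, 0, 0)" "a *\<^sub>R p + b *\<^sub>R q + c *\<^sub>R v = 0"
    by (rule complex_linear_dependence)
  define M where "M x = max \<bar>s + x * a\<bar> (max \<bar>r + x * b\<bar> \<bar>t + x * c\<bar>)" for x
  have cont: "continuous_on S M" for S
    unfolding M_def by (intro continuous_intros)
  define K where "K = max \<bar>a\<bar> (max \<bar>b\<bar> \<bar>c\<bar>)"
  have K: "\<bar>a\<bar> = K \<or> \<bar>b\<bar> = K \<or> \<bar>c\<bar> = K" "K > 0"
    using abc(1) unfolding K_def by (simp_all add: max_def) linarith
  \<comment> \<open>At \<open>X\<close> the weight with the largest coefficient has moved by $2$, hence is at least $1$ in absolute value.\<close>
  define X where "X = 2 / K"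
  have big: "\<bar>y + X * d\<bar> \<ge> 1" if "\<bar>y\<bar> \<le> 1" "\<bar>d\<bar> = K" for y d
  proof -
    have "\<bar>X * d\<bar> = 2" using K(2) that(2) by (simp add: abs_mult X_def)
    with that(1) show ?thesis by linarith
  qed
  have "M 0 \<le> 1" using assms by (simp add: M_def)
  moreover have "1 \<le> M X"
    using K(1) big[OF assms(1), of a] big[OF assms(2), of b] big[OF assms(3), of c]
    unfolding M_def le_max_iff_disj by blast
  moreover have "0 \<le> X" using K(2) by (simp add: X_def)
  ultimately obtain x where x: "M x = 1"
    using IVT'[of M 0 1 X] cont by auto
  have "(s + x * a) *\<^sub>R p + (r + x * b) *\<^sub>R q + (t + x * c) *\<^sub>R v
      = s *\<^sub>R p + r *\<^sub>R q + t *\<^sub>R v + x *\<^sub>R (a *\<^sub>R p + b *\<^sub>R q + c *\<^sub>R v)"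
    by (simp add: algebra_simps)
  with abc(2) have eq: "(s + x * a) *\<^sub>R p + (r + x * b) *\<^sub>R q + (t + x * c) *\<^sub>R v
      = s *\<^sub>R p + r *\<^sub>R q + t *\<^sub>R v" by simp
  have max1: "A \<le> 1 \<and> B \<le> 1 \<and> C \<le> 1 \<and> (A = 1 \<or> B = 1 \<or> C = 1)"
    if "max A (max B C) = 1" for A B C :: real
    using that by linarith
  show thesis
    using that[OF _ _ _ eq] max1[OF x[unfolded M_def]] by blast
qed

text \<open>
  The Barany-Grinberg argument in the plane, for all partial sums at once. The vectors arrive one at
  a time, and apart from them only a pool of two vectors with undecided weights is kept. A newcomer makes three, and
  moving their weights to the boundary settles the sign of one of them at no cost. Hence at every time the deviation
  comes from the two vectors of the pool alone, each of which still changes its weight by at most $2$. The induction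
  runs over the stream, so that the final signs of the pool may depend on the future.
\<close>
lemma rounding_with_pool:
  fixes z :: "nat \<Rightarrow> complex" and t :: "nat \<Rightarrow> real" and p q :: complex and s r b :: real
  assumes "\<And>n. norm (z n) \<le> b" "\<And>n. \<bar>t n\<bar> \<le> 1"
    and "norm p \<le> b" "norm q \<le> b" "\<bar>s\<bar> \<le> 1" "\<bar>r\<bar> \<le> 1"
  shows "\<exists>\<sigma> \<rho> \<eta>. \<bar>\<sigma>\<bar> = 1 \<and> \<bar>\<rho>\<bar> = 1 \<and> (\<forall>n. \<bar>\<eta> n\<bar> = 1) \<and>
    (\<forall>m\<le>l. norm ((\<sigma> - s) *\<^sub>R p + (\<rho> - r) *\<^sub>R q + (\<Sum>n<m. (\<eta> n - t n) *\<^sub>R z n)) \<le> 4 * b)"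
  using assms
proof (induction l arbitrary: z t p q s r)
  have start: "norm ((\<sigma> - s) *\<^sub>R p + (\<rho> - r) *\<^sub>R q) \<le> 4 * b"
    if "\<bar>\<sigma>\<bar> = 1" "\<bar>\<rho>\<bar> = 1" "norm p \<le> b" "norm q \<le> b" "\<bar>s\<bar> \<le> 1" "\<bar>r\<bar> \<le> 1"
    for \<sigma> \<rho> s r :: real and p q :: complex
  proof -
    have "\<bar>\<sigma> - s\<bar> * norm p \<le> 2 * b" "\<bar>\<rho> - r\<bar> * norm q \<le> 2 * b"
      using that by (auto intro!: mult_mono)
    then show ?thesis
      by (intro order_trans[OF norm_triangle_ineq]) simp
  qed
  { case 0
    then show ?case
      using start[of 1 1 p q s r] by (intro exI[of _ 1] exI[of _ "\<lambda>_. 1"]) auto }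
  { case (Suc l)
    obtain s' r' t' where new: "\<bar>s'\<bar> \<le> 1" "\<bar>r'\<bar> \<le> 1" "\<bar>t'\<bar> \<le> 1"
      and eq: "s' *\<^sub>R p + r' *\<^sub>R q + t' *\<^sub>R z 0 = s *\<^sub>R p + r *\<^sub>R q + t 0 *\<^sub>R z 0"
      and one: "\<bar>s'\<bar> = 1 \<or> \<bar>r'\<bar> = 1 \<or> \<bar>t'\<bar> = 1"
      using move_weight_to_boundary[of s r "t 0" p q "z 0"] Suc.prems by metis
    define Z T where "Z n = z (Suc n)" and "T n = t (Suc n)" for n
    have ZT: "norm (Z n) \<le> b" "\<bar>T n\<bar> \<le> 1" for n
      using Suc.prems by (simp_all add: Z_def T_def)
    have *: "\<exists>\<sigma> \<rho> \<tau> \<eta>. \<bar>\<sigma>\<bar> = 1 \<and> \<bar>\<rho>\<bar> = 1 \<and> \<bar>\<tau>\<bar> = 1 \<and> (\<forall>n. \<bar>\<eta> n\<bar> = 1) \<and>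
      (\<forall>m\<le>l. norm ((\<sigma> - s') *\<^sub>R p + (\<rho> - r') *\<^sub>R q + (\<tau> - t') *\<^sub>R z 0
         + (\<Sum>n<m. (\<eta> n - T n) *\<^sub>R Z n)) \<le> 4 * b)"
      using one
    proof (elim disjE)
      assume "\<bar>s'\<bar> = 1"
      with Suc.IH[of Z T q "z 0" r' t', OF ZT] Suc.prems new
      obtain \<rho> \<tau> \<eta> where "\<bar>\<rho>\<bar> = 1" "\<bar>\<tau>\<bar> = 1" "\<forall>n. \<bar>\<eta> n\<bar> = 1"
        "\<forall>m\<le>l. norm ((\<rho> - r') *\<^sub>R q + (\<tau> - t') *\<^sub>R z 0 + (\<Sum>n<m. (\<eta> n - T n) *\<^sub>R Z n)) \<le> 4 * b"
        by auto
      with \<open>\<bar>s'\<bar> = 1\<close> show ?thesis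
        by (intro exI[of _ s'] exI[of _ \<rho>] exI[of _ \<tau>] exI[of _ \<eta>]) auto
    next
      assume "\<bar>r'\<bar> = 1"
      with Suc.IH[of Z T p "z 0" s' t', OF ZT] Suc.prems new
      obtain \<sigma> \<tau> \<eta> where "\<bar>\<sigma>\<bar> = 1" "\<bar>\<tau>\<bar> = 1" "\<forall>n. \<bar>\<eta> n\<bar> = 1"
        "\<forall>m\<le>l. norm ((\<sigma> - s') *\<^sub>R p + (\<tau> - t') *\<^sub>R z 0 + (\<Sum>n<m. (\<eta> n - T n) *\<^sub>R Z n)) \<le> 4 * b"
        by auto
      with \<open>\<bar>r'\<bar> = 1\<close> show ?thesis
        by (intro exI[of _ \<sigma>] exI[of _ r'] exI[of _ \<tau>] exI[of _ \<eta>]) auto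
    next
      assume "\<bar>t'\<bar> = 1"
      with Suc.IH[of Z T p q s' r', OF ZT] Suc.prems new
      obtain \<sigma> \<tau> \<eta> where "\<bar>\<sigma>\<bar> = 1" "\<bar>\<tau>\<bar> = 1" "\<forall>n. \<bar>\<eta> n\<bar> = 1"
        "\<forall>m\<le>l. norm ((\<sigma> - s') *\<^sub>R p + (\<tau> - r') *\<^sub>R q + (\<Sum>n<m. (\<eta> n - T n) *\<^sub>R Z n)) \<le> 4 * b"
        by auto
      with \<open>\<bar>t'\<bar> = 1\<close> show ?thesis
        by (intro exI[of _ \<sigma>] exI[of _ \<tau>] exI[of _ t'] exI[of _ \<eta>]) auto
    qed
    then obtain \<sigma> \<rho> \<tau> \<eta> where signs: "\<bar>\<sigma>\<bar> = 1" "\<bar>\<rho>\<bar> = 1" "\<bar>\<tau>\<bar> = 1" "\<forall>n. \<bar>\<eta> n\<bar> = 1"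
      and bound: "\<And>m. m \<le> l \<Longrightarrow> norm ((\<sigma> - s') *\<^sub>R p + (\<rho> - r') *\<^sub>R q + (\<tau> - t') *\<^sub>R z 0
         + (\<Sum>n<m. (\<eta> n - T n) *\<^sub>R Z n)) \<le> 4 * b"
      by blast
    define \<eta>' where "\<eta>' = case_nat \<tau> \<eta>"
    have "norm ((\<sigma> - s) *\<^sub>R p + (\<rho> - r) *\<^sub>R q + (\<Sum>n<m. (\<eta>' n - t n) *\<^sub>R z n)) \<le> 4 * b"
      if "m \<le> Suc l" for m
    proof (cases m)
      case 0
      then show ?thesis using start signs Suc.prems by simp
    next
      case (Suc k)
      have "(\<sigma> - s) *\<^sub>R p + (\<rho> - r) *\<^sub>R q + (\<Sum>n<m. (\<eta>' n - t n) *\<^sub>R z n)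
          = (\<sigma> - s) *\<^sub>R p + (\<rho> - r) *\<^sub>R q + (\<tau> - t 0) *\<^sub>R z 0 + (\<Sum>n<k. (\<eta> n - T n) *\<^sub>R Z n)"
        by (simp add: Suc sum.lessThan_Suc_shift \<eta>'_def Z_def T_def del: sum.lessThan_Suc)
      also have "(\<sigma> - s) *\<^sub>R p + (\<rho> - r) *\<^sub>R q + (\<tau> - t 0) *\<^sub>R z 0
          = (\<sigma> - s') *\<^sub>R p + (\<rho> - r') *\<^sub>R q + (\<tau> - t') *\<^sub>R z 0"
        using eq by (simp add: algebra_simps)
      finally show ?thesis using bound[of k] that Suc by simp
    qed
    moreover have "\<forall>n. \<bar>\<eta>' n\<bar> = 1" using signs by (auto simp: \<eta>'_def split: nat.split)
    ultimately show ?case using signs by blast }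
qed

lemma sign_rounding:
  fixes z :: "nat \<Rightarrow> complex" and t :: "nat \<Rightarrow> real"
  assumes "\<And>n. n \<ge> N \<Longrightarrow> norm (z n) \<le> b" "\<And>n. \<bar>t n\<bar> \<le> 1"
  obtains \<eta> where "sign_seq \<eta>"
    "\<And>m. N \<le> m \<Longrightarrow> m \<le> N' \<Longrightarrow> norm (\<Sum>n\<in>{N..<m}. (\<eta> n - t n) *\<^sub>R z n) \<le> 4 * b"
proof -
  have "0 \<le> b" using assms(1)[of N] norm_ge_zero order_trans by blast
  then obtain \<eta> where \<eta>: "\<And>n. \<bar>\<eta> n\<bar> = 1"
    and bound: "\<And>m. m \<le> N' - N \<Longrightarrow> norm (\<Sum>n<m. (\<eta> n - t (n + N)) *\<^sub>R z (n + N)) \<le> 4 * b"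
    using rounding_with_pool[of "\<lambda>n. z (n + N)" b "\<lambda>n. t (n + N)" 0 0 0 0 "N' - N"] assms by auto
  show thesis
  proof (rule that[of "\<lambda>n. \<eta> (n - N)"])
    show "sign_seq (\<lambda>n. \<eta> (n - N))"
      unfolding sign_seq_def
    proof
      fix n show "\<eta> (n - N) \<in> {-1, 1}" using \<eta>[of "n - N"] by (auto simp: abs_if split: if_splits)
    qed
    fix m assume m: "N \<le> m" "m \<le> N'"
    have "(\<Sum>n\<in>{N..<m}. (\<eta> (n - N) - t n) *\<^sub>R z n) = (\<Sum>n<m - N. (\<eta> n - t (n + N)) *\<^sub>R z (n + N))"
      using m by (intro sum.reindex_bij_witness[of _ "\<lambda>n. n + N" "\<lambda>n. n - N"]) auto
    then show "norm (\<Sum>n\<in>{N..<m}. (\<eta> (n - N) - t n) *\<^sub>R z n) \<le> 4 * b"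
      using bound[of "m - N"] m by simp
  qed
qed

section \<open>Fractional combinations and gluing of blocks\<close>

text \<open>
  If the convex set of admissible sums missed \<open>w\<close>, a hyperplane would separate the two, and its normal
  \<open>g\<close> would contradict the hypothesis \<open>beyond\<close>. The weights \<open>\<mu>\<close> allow one proof for two uses: with \<open>\<mu> n = norm (z n)\<close>
  and \<open>B\<close> a multiple of \<open>norm w\<close>, they keep the partial sums of the combination within a multiple of \<open>norm w\<close>; with
  \<open>\<mu> = 0\<close> and \<open>B = 0\<close> there is no constraint.
\<close>
lemma fractional_combination:
  fixes z :: "nat \<Rightarrow> complex" and \<mu> :: "nat \<Rightarrow> real" and w :: complex
  assumes \<mu>: "\<And>n. 0 \<le> \<mu> n"
    and beyond: "\<And>g. norm g = 1 \<Longrightarrow> \<exists>M t. (\<forall>n. \<bar>t n\<bar> \<le> 1) \<and> (\<Sum>n\<in>{N..<M}. \<bar>t n\<bar> * \<mu> n) \<le> B \<and>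
      g \<bullet> w < g \<bullet> (\<Sum>n\<in>{N..<M}. t n *\<^sub>R z n)"
  obtains M t where "\<And>n. \<bar>t n\<bar> \<le> 1" "\<And>n. M \<le> n \<Longrightarrow> t n = 0"
    "(\<Sum>n\<in>{N..<M}. \<bar>t n\<bar> * \<mu> n) \<le> B" "(\<Sum>n\<in>{N..<M}. t n *\<^sub>R z n) = w"
proof -
  define ok where "ok M t \<longleftrightarrow> (\<forall>n. \<bar>t n\<bar> \<le> 1) \<and> (\<forall>n\<ge>M. t n = 0) \<and> (\<Sum>n\<in>{N..<M}. \<bar>t n\<bar> * \<mu> n) \<le> B"
    for M and t :: "nat \<Rightarrow> real"
  define K where "K = {\<Sum>n\<in>{N..<M}. t n *\<^sub>R z n | M t. ok M t}"
  have extend: "(\<Sum>n\<in>{N..<M'}. f n) = (\<Sum>n\<in>{N..<M}. f n)"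
    if "M \<le> M'" "\<And>n. n \<ge> M \<Longrightarrow> f n = 0" for M M' :: nat and f :: "nat \<Rightarrow> 'b::comm_monoid_add"
  proof (rule sum.mono_neutral_right)
    show "\<forall>i\<in>{N..<M'} - {N..<M}. f i = 0" using that(2) by auto
  qed (use that(1) in auto)
  have "convex K"
  proof (rule convexI)
    fix x y :: complex and u v :: real
    assume xy: "x \<in> K" "y \<in> K" and uv: "0 \<le> u" "0 \<le> v" "u + v = 1"
    obtain M1 t1 where 1: "ok M1 t1" "x = (\<Sum>n\<in>{N..<M1}. t1 n *\<^sub>R z n)"
      using xy by (auto simp: K_def)
    obtain M2 t2 where 2: "ok M2 t2" "y = (\<Sum>n\<in>{N..<M2}. t2 n *\<^sub>R z n)"
      using xy by (auto simp: K_def)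
    define M t where "M = max M1 M2" and "t n = u * t1 n + v * t2 n" for n
    have tabs: "\<bar>t n\<bar> \<le> u * \<bar>t1 n\<bar> + v * \<bar>t2 n\<bar>" for n
      unfolding t_def using uv by (intro order_trans[OF abs_triangle_ineq]) (simp add: abs_mult)
    have "\<bar>t n\<bar> \<le> 1" for n
    proof -
      have "u * \<bar>t1 n\<bar> \<le> u * 1" "v * \<bar>t2 n\<bar> \<le> v * 1"
        using uv 1 2 unfolding ok_def by (blast intro: mult_left_mono)+
      with tabs[of n] uv show ?thesis by linarith
    qed
    moreover have "t n = 0" if "n \<ge> M" for n
      using that 1 2 by (simp add: t_def M_def ok_def)
    moreover have "(\<Sum>n\<in>{N..<M}. \<bar>t n\<bar> * \<mu> n) \<le> B"
    proof -
      have "(\<Sum>n\<in>{N..<M}. \<bar>t n\<bar> * \<mu> n) \<le> (\<Sum>n\<in>{N..<M}. (u * \<bar>t1 n\<bar> + v * \<bar>t2 n\<bar>) * \<mu> n)"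
        using tabs \<mu> by (intro sum_mono mult_right_mono) auto
      also have "\<dots> = u * (\<Sum>n\<in>{N..<M}. \<bar>t1 n\<bar> * \<mu> n) + v * (\<Sum>n\<in>{N..<M}. \<bar>t2 n\<bar> * \<mu> n)"
        by (simp add: sum_distrib_left sum.distrib algebra_simps)
      also have "(\<Sum>n\<in>{N..<M}. \<bar>t1 n\<bar> * \<mu> n) = (\<Sum>n\<in>{N..<M1}. \<bar>t1 n\<bar> * \<mu> n)"
        using 1 by (intro extend) (auto simp: M_def ok_def)
      also have "(\<Sum>n\<in>{N..<M}. \<bar>t2 n\<bar> * \<mu> n) = (\<Sum>n\<in>{N..<M2}. \<bar>t2 n\<bar> * \<mu> n)"
        using 2 by (intro extend) (auto simp: M_def ok_def)
      also have "u * (\<Sum>n\<in>{N..<M1}. \<bar>t1 n\<bar> * \<mu> n) + v * (\<Sum>n\<in>{N..<M2}. \<bar>t2 n\<bar> * \<mu> n) \<le> u * B + v * B"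
        using uv 1 2 by (intro add_mono mult_left_mono) (auto simp: ok_def)
      also have "\<dots> = B" using uv by (metis distrib_right mult_1)
      finally show ?thesis .
    qed
    ultimately have "ok M t" by (simp add: ok_def)
    moreover have "u *\<^sub>R x + v *\<^sub>R y = (\<Sum>n\<in>{N..<M}. t n *\<^sub>R z n)"
    proof -
      have "x = (\<Sum>n\<in>{N..<M}. t1 n *\<^sub>R z n)"
        unfolding 1(2) using 1(1) by (intro extend[symmetric]) (auto simp: M_def ok_def)
      moreover have "y = (\<Sum>n\<in>{N..<M}. t2 n *\<^sub>R z n)"
        unfolding 2(2) using 2(1) by (intro extend[symmetric]) (auto simp: M_def ok_def)
      ultimately show ?thesis
        by (simp add: t_def scaleR_sum_right sum.distrib scaleR_add_left)
    qed
    ultimately show "u *\<^sub>R x + v *\<^sub>R y \<in> K" by (auto simp: K_def)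
  qed
  have "w \<in> K"
  proof (rule ccontr)
    assume "w \<notin> K"
    have "convex ((\<lambda>x. - w + x) ` K)" using \<open>convex K\<close> by (rule convex_translation)
    moreover have "0 \<notin> (\<lambda>x. - w + x) ` K" using \<open>w \<notin> K\<close> by auto
    ultimately obtain a where a0: "a \<noteq> 0" and a1: "\<forall>x\<in>(\<lambda>x. - w + x) ` K. 0 \<le> a \<bullet> x"
      using separating_hyperplane_set_0 by blast
    have a: "a \<bullet> w \<le> a \<bullet> x" if "x \<in> K" for x
      using bspec[OF a1, of "- w + x"] that by (simp add: inner_diff_right)
    define g where "g = - sgn a"
    have "norm g = 1" using a0 by (simp add: g_def norm_sgn)
    from beyond[OF this] obtain M t where t: "\<forall>n. \<bar>t n\<bar> \<le> 1" "(\<Sum>n\<in>{N..<M}. \<bar>t n\<bar> * \<mu> n) \<le> B"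
      "g \<bullet> w < g \<bullet> (\<Sum>n\<in>{N..<M}. t n *\<^sub>R z n)" by blast
    define t' where "t' n = (if n < M then t n else 0)" for n
    have "ok M t'" using t by (auto simp: ok_def t'_def)
    moreover have "(\<Sum>n\<in>{N..<M}. t n *\<^sub>R z n) = (\<Sum>n\<in>{N..<M}. t' n *\<^sub>R z n)"
      by (simp add: t'_def)
    ultimately have "(\<Sum>n\<in>{N..<M}. t n *\<^sub>R z n) \<in> K" by (auto simp: K_def)
    from a[OF this] have "inverse (norm a) * (a \<bullet> w) \<le> inverse (norm a) * (a \<bullet> (\<Sum>n\<in>{N..<M}. t n *\<^sub>R z n))"
      by (intro mult_left_mono) auto
    then have "g \<bullet> (\<Sum>n\<in>{N..<M}. t n *\<^sub>R z n) \<le> g \<bullet> w"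
      by (simp add: g_def sgn_div_norm)
    with t(3) show False by simp
  qed
  then show thesis using that by (auto simp: K_def ok_def)
qed

text \<open>
  Dependent choice over successive blocks of indices: \<open>I k N S\<close> is what stage \<open>k\<close> knows about the
  index \<open>N\<close> reached and the sum \<open>S\<close> so far, and \<open>\<beta> k\<close> bounds the excursion of the partial sums within the block.
\<close>
lemma glue_sign_blocks:
  fixes z :: "nat \<Rightarrow> complex" and I :: "nat \<Rightarrow> nat \<Rightarrow> complex \<Rightarrow> bool" and \<beta> :: "nat \<Rightarrow> real"
  assumes start: "sign_seq \<epsilon>\<^sub>0" "I 0 N\<^sub>0 (\<Sum>n<N\<^sub>0. \<epsilon>\<^sub>0 n *\<^sub>R z n)"
    and step: "\<And>k N S. I k N S \<Longrightarrow> \<exists>N' \<eta>. N < N' \<and> sign_seq \<eta> \<and> I (Suc k) N' (S + (\<Sum>n\<in>{N..<N'}. \<eta> n *\<^sub>R z n)) \<and>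
       (\<forall>m. N \<le> m \<longrightarrow> m \<le> N' \<longrightarrow> norm (\<Sum>n\<in>{N..<m}. \<eta> n *\<^sub>R z n) \<le> \<beta> k)"
  shows "\<exists>\<epsilon> stop. sign_seq \<epsilon> \<and> strict_mono stop \<and> stop 0 = N\<^sub>0 \<and> (\<forall>n<N\<^sub>0. \<epsilon> n = \<epsilon>\<^sub>0 n) \<and>
    (\<forall>k. I k (stop k) (\<Sum>n<stop k. \<epsilon> n *\<^sub>R z n)) \<and>
    (\<forall>k m. stop k \<le> m \<longrightarrow> m \<le> stop (Suc k) \<longrightarrow>
      norm ((\<Sum>n<m. \<epsilon> n *\<^sub>R z n) - (\<Sum>n<stop k. \<epsilon> n *\<^sub>R z n)) \<le> \<beta> k)"
proof -
  define P where "P k x \<longleftrightarrow> sign_seq (snd x) \<and> I k (fst x) (\<Sum>n<fst x. snd x n *\<^sub>R z n) \<and>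
    (k = 0 \<longrightarrow> x = (N\<^sub>0, \<epsilon>\<^sub>0))" for k and x :: "nat \<times> (nat \<Rightarrow> real)"
  define Q where "Q k x y \<longleftrightarrow> fst x < fst y \<and> (\<forall>n<fst x. snd y n = snd x n) \<and>
    (\<forall>m. fst x \<le> m \<longrightarrow> m \<le> fst y \<longrightarrow> norm (\<Sum>n\<in>{fst x..<m}. snd y n *\<^sub>R z n) \<le> \<beta> k)"
    for k and x y :: "nat \<times> (nat \<Rightarrow> real)"
  have "\<exists>f. \<forall>k. P k (f k) \<and> Q k (f k) (f (Suc k))"
  proof (rule dependent_nat_choice)
    show "\<exists>x. P 0 x" using start by (intro exI[of _ "(N\<^sub>0, \<epsilon>\<^sub>0)"]) (simp add: P_def)
  next
    fix x k assume "P k x"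
    obtain N \<epsilon> where x: "x = (N, \<epsilon>)" by (cases x)
    from \<open>P k x\<close> have \<epsilon>: "sign_seq \<epsilon>" "I k N (\<Sum>n<N. \<epsilon> n *\<^sub>R z n)" by (auto simp: P_def x)
    from step[OF \<epsilon>(2)] obtain N' \<eta> where \<eta>: "N < N'" "sign_seq \<eta>"
      "I (Suc k) N' ((\<Sum>n<N. \<epsilon> n *\<^sub>R z n) + (\<Sum>n\<in>{N..<N'}. \<eta> n *\<^sub>R z n))"
      "\<And>m. N \<le> m \<Longrightarrow> m \<le> N' \<Longrightarrow> norm (\<Sum>n\<in>{N..<m}. \<eta> n *\<^sub>R z n) \<le> \<beta> k"
      by blast
    define \<epsilon>' where "\<epsilon>' n = (if n < N then \<epsilon> n else \<eta> n)" for n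
    have tail: "(\<Sum>n\<in>{N..<m}. \<epsilon>' n *\<^sub>R z n) = (\<Sum>n\<in>{N..<m}. \<eta> n *\<^sub>R z n)" for m
      by (intro sum.cong) (auto simp: \<epsilon>'_def)
    have "(\<Sum>n<N'. \<epsilon>' n *\<^sub>R z n) = (\<Sum>n<N. \<epsilon>' n *\<^sub>R z n) + (\<Sum>n\<in>{N..<N'}. \<epsilon>' n *\<^sub>R z n)"
      using \<eta>(1) sum.atLeastLessThan_concat[of 0 N N' "\<lambda>n. \<epsilon>' n *\<^sub>R z n"]
      by (simp add: atLeast0LessThan)
    also have "(\<Sum>n<N. \<epsilon>' n *\<^sub>R z n) = (\<Sum>n<N. \<epsilon> n *\<^sub>R z n)" by (simp add: \<epsilon>'_def)
    finally have "P (Suc k) (N', \<epsilon>') \<and> Q k x (N', \<epsilon>')"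
      using \<eta> \<epsilon> by (auto simp: P_def Q_def x tail) (auto simp: \<epsilon>'_def sign_seq_def)
    then show "\<exists>y. P (Suc k) y \<and> Q k x y" by blast
  qed
  then obtain f where P: "\<And>k. P k (f k)" and Q: "\<And>k. Q k (f k) (f (Suc k))" by blast
  define stop where "stop k = fst (f k)" for k
  define \<epsilon> where "\<epsilon> n = snd (f (Suc n)) n" for n
  have mono: "strict_mono stop"
    using Q unfolding strict_mono_Suc_iff by (auto simp: stop_def Q_def)
  have stable: "snd (f (k + j)) n = snd (f k) n" if "n < stop k" for k j n
  proof (induction j)
    case (Suc j)
    have "n < stop (k + j)" using that strict_mono_leD[OF mono, of k "k + j"] by simp
    with Q[of "k + j"] Suc show ?case by (simp add: Q_def stop_def)
  qed simp
  have agree: "\<epsilon> n = snd (f k) n" if "n < stop k" for n k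
  proof -
    have "n < stop (Suc n)" using strict_mono_imp_increasing[OF mono, of "Suc n"] by simp
    then have "snd (f (Suc n + k)) n = \<epsilon> n" using stable[of n "Suc n" k] by (simp add: \<epsilon>_def)
    moreover have "snd (f (k + Suc n)) n = snd (f k) n" using stable[of n k "Suc n"] that by simp
    ultimately show ?thesis by (simp add: add.commute)
  qed
  show ?thesis
  proof (intro exI conjI allI impI)
    show "sign_seq \<epsilon>" using P unfolding \<epsilon>_def sign_seq_def P_def by blast
    show "strict_mono stop" by fact
    have f0: "f 0 = (N\<^sub>0, \<epsilon>\<^sub>0)" using P[of 0] by (simp add: P_def)
    then show "stop 0 = N\<^sub>0" by (simp add: stop_def)
    show "\<epsilon> n = \<epsilon>\<^sub>0 n" if "n < N\<^sub>0" for n using agree[of n 0] that f0 by (simp add: stop_def)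
    show "I k (stop k) (\<Sum>n<stop k. \<epsilon> n *\<^sub>R z n)" for k
      using P[of k] agree[of _ k] by (simp add: P_def stop_def)
    fix k m assume m: "stop k \<le> m" "m \<le> stop (Suc k)"
    have "(\<Sum>n<m. \<epsilon> n *\<^sub>R z n) - (\<Sum>n<stop k. \<epsilon> n *\<^sub>R z n) = (\<Sum>n\<in>{stop k..<m}. \<epsilon> n *\<^sub>R z n)"
      using m sum.atLeastLessThan_concat[of 0 "stop k" m "\<lambda>n. \<epsilon> n *\<^sub>R z n"]
      by (simp add: atLeast0LessThan algebra_simps)
    also have "\<dots> = (\<Sum>n\<in>{stop k..<m}. snd (f (Suc k)) n *\<^sub>R z n)"
      using m agree[of _ "Suc k"] by (intro sum.cong) auto
    finally show "norm ((\<Sum>n<m. \<epsilon> n *\<^sub>R z n) - (\<Sum>n<stop k. \<epsilon> n *\<^sub>R z n)) \<le> \<beta> k"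
      using Q[of k] m by (simp add: Q_def stop_def)
  qed
qed

lemma tendsto_from_cuts:
  fixes S :: "nat \<Rightarrow> complex" and stop :: "nat \<Rightarrow> nat" and \<beta> :: "nat \<Rightarrow> real"
  assumes mono: "strict_mono stop" and lim: "(\<lambda>k. S (stop k)) \<longlonglongrightarrow> l" and \<beta>: "\<beta> \<longlonglongrightarrow> 0"
    and close: "\<And>k m. stop k \<le> m \<Longrightarrow> m \<le> stop (Suc k) \<Longrightarrow> norm (S m - S (stop k)) \<le> \<beta> k"
  shows "S \<longlonglongrightarrow> l"
proof (rule LIMSEQ_I)
  fix r :: real assume "r > 0"
  then obtain K1 where K1: "\<And>k. k \<ge> K1 \<Longrightarrow> norm (S (stop k) - l) < r / 2"
    using LIMSEQ_D[OF lim, of "r / 2"] by auto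
  obtain K2 where K2: "\<And>k. k \<ge> K2 \<Longrightarrow> norm (\<beta> k - 0) < r / 2"
    using LIMSEQ_D[OF \<beta>, of "r / 2"] \<open>r > 0\<close> by auto
  define K where "K = max K1 K2"
  have "norm (S m - l) < r" if m: "m \<ge> stop K" for m
  proof -
    have "\<exists>j. m < stop j" using strict_mono_imp_increasing[OF mono, of "Suc m"] Suc_le_eq by blast
    define j where "j = (LEAST j. m < stop j)"
    have j: "m < stop j" unfolding j_def by (rule LeastI_ex) fact
    have "j > K" using j m strict_mono_less[OF mono] by (metis le_less_trans)
    then obtain k where k: "j = Suc k" "k \<ge> K" by (cases j) auto
    have "stop k \<le> m" using not_less_Least[of k "\<lambda>j. m < stop j"] k unfolding j_def by force
    then have "norm (S m - S (stop k)) \<le> \<beta> k" using close j k by simp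
    moreover have "\<beta> k < r / 2" using K2[of k] k by (simp add: K_def)
    moreover have "norm (S (stop k) - l) < r / 2" using K1[of k] k by (simp add: K_def)
    ultimately show ?thesis
      using norm_triangle_ineq[of "S m - S (stop k)" "S (stop k) - l"] by simp
  qed
  then show "\<exists>no. \<forall>m\<ge>no. norm (S m - l) < r" by blast
qed

lemma tail_sums_unbounded:
  fixes f :: "nat \<Rightarrow> real"
  assumes "\<And>n. 0 \<le> f n" "\<not> summable f"
  obtains M where "B < (\<Sum>n\<in>{N..<M}. f n)"
proof (rule ccontr)
  assume no: "\<not> thesis"
  have "summable (\<lambda>n. f (n + N))"
  proof (rule summableI_nonneg_bounded)
    fix n
    have "(\<Sum>i<n. f (i + N)) = (\<Sum>i\<in>{N..<N + n}. f i)"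
      by (intro sum.reindex_bij_witness[of _ "\<lambda>n. n - N" "\<lambda>n. n + N"]) auto
    then show "(\<Sum>i<n. f (i + N)) \<le> B" using no that not_less by metis
  qed (use assms in auto)
  with assms show False using summable_iff_shift by blast
qed

section \<open>Which sums are attained by choosing signs\<close>

text \<open>
  For a unit vector \<open>g\<close> only those terms are used on which \<open>g\<close> is at least \<open>\<kappa>\<close> times the length. On them
  the gain in direction \<open>g\<close> is at least \<open>\<kappa>\<close> times the length spent, so a total length \<open>2 * norm e / \<kappa>\<close> passes beyond \<open>e\<close>
  in every direction.
\<close>
lemma cone_combination:
  fixes z :: "nat \<Rightarrow> complex"
  assumes \<kappa>: "\<kappa> > 0"
    and cone: "\<And>g. norm g = 1 \<Longrightarrow> \<not> summable (\<lambda>n. if \<kappa> * norm (z n) \<le> \<bar>g \<bullet> z n\<bar> then norm (z n) else 0)"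
  obtains M t where "\<And>n. \<bar>t n\<bar> \<le> 1" "\<And>m. (\<Sum>n\<in>{N..<m}. \<bar>t n\<bar> * norm (z n)) \<le> 2 * norm e / \<kappa>"
    "\<And>m. M \<le> m \<Longrightarrow> (\<Sum>n\<in>{N..<m}. t n *\<^sub>R z n) = e"
proof (cases "e = 0")
  case True
  then show thesis using that[of "\<lambda>_. 0" 0] \<kappa> by simp
next
  case False
  define B where "B = 2 * norm e / \<kappa>"
  have "B > 0" using False \<kappa> by (simp add: B_def)
  have beyond: "\<exists>M t. (\<forall>n. \<bar>t n\<bar> \<le> 1) \<and> (\<Sum>n\<in>{N..<M}. \<bar>t n\<bar> * norm (z n)) \<le> B \<and>
      g \<bullet> e < g \<bullet> (\<Sum>n\<in>{N..<M}. t n *\<^sub>R z n)" if g: "norm g = 1" for g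
  proof -
    define f where "f n = (if \<kappa> * norm (z n) \<le> \<bar>g \<bullet> z n\<bar> then norm (z n) else 0)" for n
    have f0: "f n \<ge> 0" for n by (simp add: f_def)
    have "\<not> summable f" using cone[OF g] unfolding f_def[abs_def] .
    then obtain M where M: "B < (\<Sum>n\<in>{N..<M}. f n)"
      by (rule tail_sums_unbounded[OF f0])
    \<comment> \<open>Scaling makes the cost exactly \<open>B\<close>, although the sum of the lengths overshoots.\<close>
    define \<theta> where "\<theta> = B / (\<Sum>n\<in>{N..<M}. f n)"
    have \<theta>: "0 \<le> \<theta>" "\<theta> \<le> 1" "\<theta> * (\<Sum>n\<in>{N..<M}. f n) = B"
      using M \<open>B > 0\<close> by (auto simp: \<theta>_def)
    define t where "t n = (if \<kappa> * norm (z n) \<le> \<bar>g \<bullet> z n\<bar> then \<theta> * sgn (g \<bullet> z n) else 0)" for n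
    have t1: "\<bar>t n\<bar> \<le> 1" for n
      using \<theta> by (auto simp: t_def abs_mult sgn_if)
    have "(\<Sum>n\<in>{N..<M}. \<bar>t n\<bar> * norm (z n)) \<le> (\<Sum>n\<in>{N..<M}. \<theta> * f n)"
      using \<theta> by (intro sum_mono) (auto simp: t_def f_def abs_mult sgn_if)
    also have "\<dots> = B" using \<theta>(3) by (simp add: sum_distrib_left)
    finally have cost: "(\<Sum>n\<in>{N..<M}. \<bar>t n\<bar> * norm (z n)) \<le> B" .
    have "g \<bullet> e \<le> norm e" using norm_cauchy_schwarz[of g e] g by simp
    also have "\<dots> < \<kappa> * B" using False \<kappa> by (simp add: B_def)
    also have "\<dots> = (\<Sum>n\<in>{N..<M}. \<kappa> * (\<theta> * f n))"
      unfolding \<theta>(3)[symmetric] by (simp add: sum_distrib_left)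
    also have "\<dots> \<le> (\<Sum>n\<in>{N..<M}. t n * (g \<bullet> z n))"
    proof (intro sum_mono)
      fix n
      show "\<kappa> * (\<theta> * f n) \<le> t n * (g \<bullet> z n)"
      proof (cases "\<kappa> * norm (z n) \<le> \<bar>g \<bullet> z n\<bar>")
        case True
        have "\<theta> * (\<kappa> * norm (z n)) \<le> \<theta> * \<bar>g \<bullet> z n\<bar>"
          using True \<theta> by (intro mult_left_mono) auto
        then show ?thesis using True
          by (simp add: t_def f_def mult.assoc mult.left_commute abs_sgn mult.commute)
      qed (simp add: t_def f_def)
    qed
    also have "\<dots> = g \<bullet> (\<Sum>n\<in>{N..<M}. t n *\<^sub>R z n)" by (simp add: inner_sum_right)
    finally show ?thesis using t1 cost by blast
  qed
  obtain M t where t: "\<And>n. \<bar>t n\<bar> \<le> 1" "\<And>n. M \<le> n \<Longrightarrow> t n = 0"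
    "(\<Sum>n\<in>{N..<M}. \<bar>t n\<bar> * norm (z n)) \<le> B" "(\<Sum>n\<in>{N..<M}. t n *\<^sub>R z n) = e"
    using fractional_combination[of "\<lambda>n. norm (z n)" N B e z, OF norm_ge_zero beyond] by blast
  show thesis
  proof (rule that[OF t(1)])
    fix m
    have "(\<Sum>n\<in>{N..<m}. \<bar>t n\<bar> * norm (z n)) = (\<Sum>n\<in>{N..<min m M}. \<bar>t n\<bar> * norm (z n))"
      using t(2) by (intro sum.mono_neutral_right) auto
    also have "\<dots> \<le> (\<Sum>n\<in>{N..<M}. \<bar>t n\<bar> * norm (z n))" by (intro sum_mono2) auto
    finally show "(\<Sum>n\<in>{N..<m}. \<bar>t n\<bar> * norm (z n)) \<le> 2 * norm e / \<kappa>"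
      using t(3) unfolding B_def by linarith
  next
    fix m assume "M \<le> m"
    then have "(\<Sum>n\<in>{N..<m}. t n *\<^sub>R z n) = (\<Sum>n\<in>{N..<M}. t n *\<^sub>R z n)"
      using t(2) by (intro sum.mono_neutral_right) auto
    then show "(\<Sum>n\<in>{N..<m}. t n *\<^sub>R z n) = e" using t(4) by simp
  qed
qed

text \<open>
  At each stage the missing vector \<open>w - S\<close> is written as a fractional combination of later terms, of total
  length at most a multiple of \<open>norm (w - S)\<close>, and the weights are rounded to signs. The new error is at most four times the
  size of the terms used. Both the error and the excursions therefore tend to $0$, and the series converges to \<open>w\<close>
  itself. The cone condition is what bounds the excursions: without it, the combination reaching \<open>w - S\<close> may have to
  make a long detour.
\<close>
theorem exact_sign_sum:
  fixes z :: "nat \<Rightarrow> complex"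
  assumes z0: "z \<longlonglongrightarrow> 0" and \<kappa>: "\<kappa> > 0"
    and cone: "\<And>g. norm g = 1 \<Longrightarrow> \<not> summable (\<lambda>n. if \<kappa> * norm (z n) \<le> \<bar>g \<bullet> z n\<bar> then norm (z n) else 0)"
  obtains \<epsilon> where "sign_seq \<epsilon>" "(\<lambda>n. \<epsilon> n *\<^sub>R z n) sums w"
proof -
  obtain C where C: "C > 0" "\<And>n. norm (z n) \<le> C"
    using z0 by (metis BseqE convergentI convergent_imp_Bseq)
  \<comment> \<open>Chosen so that the initial error is at most \<open>D\<close> and the rounding error \<open>4 * C / 2 ^ k\<close> of a stage is at most \<open>D / 2 ^ Suc k\<close>.\<close>
  define D where "D = norm w + 8 * C"
  define I where "I k N S \<longleftrightarrow> norm (w - S) \<le> D / 2 ^ k \<and> (\<forall>n\<ge>N. norm (z n) \<le> C / 2 ^ k)"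
    for k N :: nat and S
  define \<beta> where "\<beta> k = (4 * C + 2 * D / \<kappa>) / 2 ^ k" for k :: nat
  have step: "\<exists>N' \<eta>. N < N' \<and> sign_seq \<eta> \<and> I (Suc k) N' (S + (\<Sum>n\<in>{N..<N'}. \<eta> n *\<^sub>R z n)) \<and>
       (\<forall>m. N \<le> m \<longrightarrow> m \<le> N' \<longrightarrow> norm (\<Sum>n\<in>{N..<m}. \<eta> n *\<^sub>R z n) \<le> \<beta> k)" if I: "I k N S" for k N S
  proof -
    obtain M t where t: "\<And>n. \<bar>t n\<bar> \<le> 1"
      "\<And>m. (\<Sum>n\<in>{N..<m}. \<bar>t n\<bar> * norm (z n)) \<le> 2 * norm (w - S) / \<kappa>"
      "\<And>m. M \<le> m \<Longrightarrow> (\<Sum>n\<in>{N..<m}. t n *\<^sub>R z n) = w - S"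
      using cone_combination[OF \<kappa> cone] by metis
    obtain M' where M': "\<And>n. n \<ge> M' \<Longrightarrow> norm (z n) \<le> C / 2 ^ Suc k"
      using LIMSEQ_D[OF z0, of "C / 2 ^ Suc k"] C by (auto simp: less_eq_real_def)
    define N' where "N' = max (Suc N) (max M M')"
    obtain \<eta> where \<eta>: "sign_seq \<eta>" and round: "\<And>m. N \<le> m \<Longrightarrow> m \<le> N' \<Longrightarrow>
        norm (\<Sum>n\<in>{N..<m}. (\<eta> n - t n) *\<^sub>R z n) \<le> 4 * (C / 2 ^ k)"
      using sign_rounding[of N z "C / 2 ^ k" t N'] I t(1) unfolding I_def by metis
    have split: "(\<Sum>n\<in>{N..<m}. \<eta> n *\<^sub>R z n) = (\<Sum>n\<in>{N..<m}. (\<eta> n - t n) *\<^sub>R z n) + (\<Sum>n\<in>{N..<m}. t n *\<^sub>R z n)" for m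
      by (simp add: sum.distrib[symmetric] scaleR_diff_left)
    have "norm (\<Sum>n\<in>{N..<m}. \<eta> n *\<^sub>R z n) \<le> \<beta> k" if m: "N \<le> m" "m \<le> N'" for m
    proof -
      have "norm (\<Sum>n\<in>{N..<m}. t n *\<^sub>R z n) \<le> (\<Sum>n\<in>{N..<m}. \<bar>t n\<bar> * norm (z n))"
        by (intro sum_norm_le) simp
      also have "\<dots> \<le> 2 * norm (w - S) / \<kappa>" by (rule t(2))
      also have "\<dots> \<le> 2 * (D / 2 ^ k) / \<kappa>"
        using I \<kappa> by (intro divide_right_mono mult_left_mono) (auto simp: I_def)
      finally have "norm (\<Sum>n\<in>{N..<m}. t n *\<^sub>R z n) \<le> 2 * (D / 2 ^ k) / \<kappa>" .
      with round[OF m] have "norm (\<Sum>n\<in>{N..<m}. \<eta> n *\<^sub>R z n) \<le> 4 * (C / 2 ^ k) + 2 * (D / 2 ^ k) / \<kappa>"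
        unfolding split by (intro norm_triangle_mono)
      then show ?thesis by (simp add: \<beta>_def add_divide_distrib mult.commute)
    qed
    moreover have "norm (w - (S + (\<Sum>n\<in>{N..<N'}. \<eta> n *\<^sub>R z n))) \<le> D / 2 ^ Suc k"
    proof -
      have "w - (S + (\<Sum>n\<in>{N..<N'}. \<eta> n *\<^sub>R z n)) = - (\<Sum>n\<in>{N..<N'}. (\<eta> n - t n) *\<^sub>R z n)"
        unfolding split[of N'] using t(3)[of N'] by (simp add: N'_def)
      then have "norm (w - (S + (\<Sum>n\<in>{N..<N'}. \<eta> n *\<^sub>R z n))) \<le> 4 * (C / 2 ^ k)"
        using round[of N'] by (simp add: N'_def)
      also have "\<dots> = 8 * C / 2 ^ Suc k" by simp
      also have "\<dots> \<le> D / 2 ^ Suc k" by (intro divide_right_mono) (auto simp: D_def)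
      finally show ?thesis .
    qed
    moreover have "\<forall>n\<ge>N'. norm (z n) \<le> C / 2 ^ Suc k" using M' by (simp add: N'_def)
    moreover have "N < N'" by (simp add: N'_def)
    ultimately show ?thesis using \<eta> unfolding I_def by blast
  qed
  have start: "sign_seq (\<lambda>_. 1)" "I 0 0 (\<Sum>n<0. 1 *\<^sub>R z n)"
    using C by (simp_all add: sign_seq_def I_def D_def)
  obtain \<epsilon> stop where \<epsilon>: "sign_seq \<epsilon>" and stop: "strict_mono stop"
    and inv: "\<And>k. I k (stop k) (\<Sum>n<stop k. \<epsilon> n *\<^sub>R z n)"
    and close: "\<And>k m. stop k \<le> m \<Longrightarrow> m \<le> stop (Suc k) \<Longrightarrow>
       norm ((\<Sum>n<m. \<epsilon> n *\<^sub>R z n) - (\<Sum>n<stop k. \<epsilon> n *\<^sub>R z n)) \<le> \<beta> k"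
    using glue_sign_blocks[of "\<lambda>_. 1" I 0 z \<beta>, OF start step] by blast
  have geo: "(\<lambda>k. x / 2 ^ k) \<longlonglongrightarrow> 0" for x :: real
    by (rule LIMSEQ_divide_realpow_zero) simp
  have "(\<lambda>k. (\<Sum>n<stop k. \<epsilon> n *\<^sub>R z n) - w) \<longlonglongrightarrow> 0"
  proof (rule Lim_null_comparison[OF _ geo[of D]])
    have "norm ((\<Sum>n<stop k. \<epsilon> n *\<^sub>R z n) - w) \<le> D / 2 ^ k" for k
      using inv[of k] unfolding I_def by (subst norm_minus_commute) blast
    then show "\<forall>\<^sub>F k in sequentially. norm ((\<Sum>n<stop k. \<epsilon> n *\<^sub>R z n) - w) \<le> D / 2 ^ k"
      by (rule always_eventually[OF allI])
  qed
  then have "(\<lambda>k. \<Sum>n<stop k. \<epsilon> n *\<^sub>R z n) \<longlonglongrightarrow> w" by (simp add: LIM_zero_iff)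
  moreover have "\<beta> \<longlonglongrightarrow> 0" unfolding \<beta>_def by (rule geo)
  ultimately have "(\<lambda>m. \<Sum>n<m. \<epsilon> n *\<^sub>R z n) \<longlonglongrightarrow> w"
    using tendsto_from_cuts[OF stop, of "\<lambda>m. \<Sum>n<m. \<epsilon> n *\<^sub>R z n" w \<beta>] close by blast
  with \<epsilon> that show thesis by (simp add: sums_def)
qed

text \<open>
  Unbounded width in every direction suffices to get near \<open>w\<close> once: write the missing vector as a
  fractional combination of small terms and round. After that the remaining terms are only balanced against each other, in
  blocks on which they are at most \<open>b / 2 ^ k\<close>; this makes the series converge and moves the sum by at most \<open>8 * b\<close>.
\<close>
theorem dense_sign_sums:
  fixes z :: "nat \<Rightarrow> complex"
  assumes z0: "z \<longlonglongrightarrow> 0" and \<delta>: "\<delta> > 0"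
    and width: "\<And>g. norm g = 1 \<Longrightarrow> \<not> summable (\<lambda>n. \<bar>g \<bullet> z n\<bar>)"
  obtains \<epsilon> l where "sign_seq \<epsilon>" "(\<lambda>n. \<epsilon> n *\<^sub>R z n) sums l" "l \<in> ball w \<delta>"
proof -
  \<comment> \<open>Reaching \<open>w\<close> costs an error of \<open>4 * b\<close> and the balanced tail \<open>8 * b\<close>, which together stay below \<open>\<delta>\<close>.\<close>
  define b where "b = \<delta> / 16"
  have b: "b > 0" using \<delta> by (simp add: b_def)
  obtain N where N: "\<And>n. n \<ge> N \<Longrightarrow> norm (z n) \<le> b"
    using LIMSEQ_D[OF z0 b] by (auto simp: less_eq_real_def)
  define e where "e = w - (\<Sum>n<N. z n)"
  have beyond: "\<exists>M t. (\<forall>n. \<bar>t n\<bar> \<le> 1) \<and> (\<Sum>n\<in>{N..<M}. \<bar>t n\<bar> * 0) \<le> 0 \<and>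
      g \<bullet> e < g \<bullet> (\<Sum>n\<in>{N..<M}. t n *\<^sub>R z n)" if g: "norm g = 1" for g
  proof -
    obtain M where "g \<bullet> e < (\<Sum>n\<in>{N..<M}. \<bar>g \<bullet> z n\<bar>)"
      by (rule tail_sums_unbounded[OF abs_ge_zero width[OF g]])
    then have "g \<bullet> e < g \<bullet> (\<Sum>n\<in>{N..<M}. sgn (g \<bullet> z n) *\<^sub>R z n)"
      by (simp add: inner_sum_right abs_sgn mult.commute)
    then show ?thesis by (intro exI[of _ M] exI[of _ "\<lambda>n. sgn (g \<bullet> z n)"]) (simp add: sgn_if)
  qed
  obtain M t where t: "\<And>n. \<bar>t n\<bar> \<le> 1" "\<And>n. M \<le> n \<Longrightarrow> t n = 0" "(\<Sum>n\<in>{N..<M}. t n *\<^sub>R z n) = e"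
    using fractional_combination[of "\<lambda>_. 0" N 0 e z, OF order_refl beyond] by blast
  define M' where "M' = max N M"
  obtain \<eta> where \<eta>: "sign_seq \<eta>" and round: "\<And>m. N \<le> m \<Longrightarrow> m \<le> M' \<Longrightarrow>
      norm (\<Sum>n\<in>{N..<m}. (\<eta> n - t n) *\<^sub>R z n) \<le> 4 * b"
    using sign_rounding[of N z b t M'] N t(1) by metis
  define \<epsilon>\<^sub>0 where "\<epsilon>\<^sub>0 n = (if n < N then 1 else \<eta> n)" for n
  have \<epsilon>\<^sub>0: "sign_seq \<epsilon>\<^sub>0" using \<eta> by (simp add: sign_seq_def \<epsilon>\<^sub>0_def)
  have start: "norm ((\<Sum>n<M'. \<epsilon>\<^sub>0 n *\<^sub>R z n) - w) \<le> 4 * b"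
  proof -
    have "(\<Sum>n<M'. \<epsilon>\<^sub>0 n *\<^sub>R z n) = (\<Sum>n<N. \<epsilon>\<^sub>0 n *\<^sub>R z n) + (\<Sum>n\<in>{N..<M'}. \<epsilon>\<^sub>0 n *\<^sub>R z n)"
      using sum.atLeastLessThan_concat[of 0 N M' "\<lambda>n. \<epsilon>\<^sub>0 n *\<^sub>R z n"]
      by (simp add: atLeast0LessThan M'_def)
    also have "(\<Sum>n<N. \<epsilon>\<^sub>0 n *\<^sub>R z n) = w - e" by (simp add: \<epsilon>\<^sub>0_def e_def)
    also have "e = (\<Sum>n\<in>{N..<M'}. t n *\<^sub>R z n)"
      unfolding t(3)[symmetric] using t(2) by (intro sum.mono_neutral_left) (auto simp: M'_def)
    also have "(\<Sum>n\<in>{N..<M'}. \<epsilon>\<^sub>0 n *\<^sub>R z n) = (\<Sum>n\<in>{N..<M'}. \<eta> n *\<^sub>R z n)" by (simp add: \<epsilon>\<^sub>0_def)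
    finally have "(\<Sum>n<M'. \<epsilon>\<^sub>0 n *\<^sub>R z n) - w = (\<Sum>n\<in>{N..<M'}. (\<eta> n - t n) *\<^sub>R z n)"
      by (simp add: scaleR_diff_left sum_subtractf)
    then show ?thesis using round[of M'] by (simp add: M'_def)
  qed
  define I where "I k n S \<longleftrightarrow> (\<forall>m\<ge>n. norm (z m) \<le> b / 2 ^ k)" for k n :: nat and S :: complex
  define \<beta> where "\<beta> k = 4 * b / 2 ^ k" for k :: nat
  have step: "\<exists>N' \<eta>. N < N' \<and> sign_seq \<eta> \<and> I (Suc k) N' (S + (\<Sum>n\<in>{N..<N'}. \<eta> n *\<^sub>R z n)) \<and>
       (\<forall>m. N \<le> m \<longrightarrow> m \<le> N' \<longrightarrow> norm (\<Sum>n\<in>{N..<m}. \<eta> n *\<^sub>R z n) \<le> \<beta> k)" if I: "I k N S" for k N S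
  proof -
    obtain N'' where N'': "\<And>n. n \<ge> N'' \<Longrightarrow> norm (z n) \<le> b / 2 ^ Suc k"
      using LIMSEQ_D[OF z0, of "b / 2 ^ Suc k"] b by (auto simp: less_eq_real_def)
    define N' where "N' = max (Suc N) N''"
    have small: "\<And>n. n \<ge> N \<Longrightarrow> norm (z n) \<le> b / 2 ^ k" using I by (simp add: I_def)
    have "\<And>n::nat. \<bar>0::real\<bar> \<le> 1" by simp
    from sign_rounding[of N z "b / 2 ^ k" "\<lambda>_. 0" N', OF small this] obtain \<eta> where \<eta>: "sign_seq \<eta>"
      "\<And>m. N \<le> m \<Longrightarrow> m \<le> N' \<Longrightarrow> norm (\<Sum>n\<in>{N..<m}. (\<eta> n - 0) *\<^sub>R z n) \<le> 4 * (b / 2 ^ k)"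
      by blast
    show ?thesis
    proof (intro exI conjI allI impI)
      show "N < N'" by (simp add: N'_def)
      show "I (Suc k) N' (S + (\<Sum>n\<in>{N..<N'}. \<eta> n *\<^sub>R z n))"
        using N'' by (simp add: I_def N'_def)
      show "norm (\<Sum>n\<in>{N..<m}. \<eta> n *\<^sub>R z n) \<le> \<beta> k" if "N \<le> m" "m \<le> N'" for m
        using \<eta>(2)[OF that] by (simp add: \<beta>_def)
    qed (rule \<eta>(1))
  qed
  have I0: "I 0 M' (\<Sum>n<M'. \<epsilon>\<^sub>0 n *\<^sub>R z n)" using N by (simp add: I_def M'_def)
  obtain \<epsilon> stop where \<epsilon>: "sign_seq \<epsilon>" and stop: "strict_mono stop" "stop 0 = M'"
    and initial: "\<And>n. n < M' \<Longrightarrow> \<epsilon> n = \<epsilon>\<^sub>0 n"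
    and close: "\<And>k m. stop k \<le> m \<Longrightarrow> m \<le> stop (Suc k) \<Longrightarrow>
       norm ((\<Sum>n<m. \<epsilon> n *\<^sub>R z n) - (\<Sum>n<stop k. \<epsilon> n *\<^sub>R z n)) \<le> \<beta> k"
    using glue_sign_blocks[of \<epsilon>\<^sub>0 I M' z \<beta>, OF \<epsilon>\<^sub>0 I0 step] by blast
  define S where "S m = (\<Sum>n<m. \<epsilon> n *\<^sub>R z n)" for m
  define d where "d k = S (stop (Suc k)) - S (stop k)" for k
  have "\<beta> = (\<lambda>k. 4 * b * (1 / 2) ^ k)" by (simp add: fun_eq_iff \<beta>_def power_divide)
  then have \<beta>: "\<beta> sums (8 * b)"
    using sums_mult[OF geometric_sums[of "1 / 2 :: real"], of "4 * b"] by simp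
  have d: "norm (d k) \<le> \<beta> k" for k
    unfolding d_def S_def using close[of k "stop (Suc k)"] strict_monoD[OF stop(1), of k "Suc k"] by simp
  have \<beta>_summable: "summable \<beta>" and \<beta>_total: "suminf \<beta> = 8 * b"
    using \<beta> by (simp_all only: sums_iff)
  have sn: "summable (\<lambda>k. norm (d k))"
    by (rule summable_comparison_test'[OF \<beta>_summable]) (simp add: d)
  have "summable d" by (rule summable_norm_cancel[OF sn])
  then have "d sums suminf d" by (rule summable_sums)
  moreover have "(\<Sum>k<n. d k) = S (stop n) - S M'" for n
    unfolding d_def using sum_lessThan_telescope[of "\<lambda>k. S (stop k)" n] by (simp add: stop(2))
  ultimately have "(\<lambda>n. S (stop n) - S M') \<longlonglongrightarrow> suminf d" by (simp add: sums_def)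
  then have "(\<lambda>n. S (stop n) - S M' + S M') \<longlonglongrightarrow> suminf d + S M'" by (intro tendsto_intros)
  then have "(\<lambda>n. S (stop n)) \<longlonglongrightarrow> suminf d + S M'" by simp
  then have lim: "S \<longlonglongrightarrow> suminf d + S M'"
    by (rule tendsto_from_cuts[OF stop(1) _ summable_LIMSEQ_zero[OF \<beta>_summable]])
      (use close in \<open>simp add: S_def\<close>)
  have "norm (suminf d) \<le> (\<Sum>k. norm (d k))" by (rule summable_norm[OF sn])
  also have "\<dots> \<le> suminf \<beta>" using d sn \<beta>_summable by (rule suminf_le)
  finally have "norm (suminf d) \<le> 8 * b" unfolding \<beta>_total .
  moreover have "norm (S M' - w) \<le> 4 * b" using start initial by (simp add: S_def)
  ultimately have "norm (suminf d + (S M' - w)) \<le> 12 * b"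
    using norm_triangle_ineq[of "suminf d" "S M' - w"] by linarith
  also have "\<dots> < \<delta>" using \<delta> by (simp add: b_def)
  finally have "suminf d + S M' \<in> ball w \<delta>"
    by (simp add: dist_norm norm_minus_commute[of w] algebra_simps)
  moreover have "(\<lambda>n. \<epsilon> n *\<^sub>R z n) sums (suminf d + S M')"
    using lim unfolding S_def[abs_def] sums_def .
  ultimately show thesis using that \<epsilon> by blast
qed

section \<open>Binary digits and Hausdorff dimension\<close>

lemma R_cases: "R x \<in> {-1, 1}" by (simp add: R_def)

lemma floor_double: "\<lfloor>2 * y\<rfloor> = 2 * \<lfloor>y\<rfloor> + (if R y = 1 then 0 else 1)" for y :: real
proof (cases "frac y < 1/2")
  case True
  have "\<lfloor>2 * y\<rfloor> = 2 * \<lfloor>y\<rfloor>"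
    using True frac_ge_0[of y] by (intro floor_unique) (auto simp: frac_def)
  with True show ?thesis by (simp add: R_def)
next
  case False
  have "\<lfloor>2 * y\<rfloor> = 2 * \<lfloor>y\<rfloor> + 1"
    using False frac_lt_1[of y] by (intro floor_unique) (auto simp: frac_def)
  with False show ?thesis by (simp add: R_def)
qed

text \<open>
  The value \<open>R (2 ^ n * x)\<close> encodes the binary digit of \<open>x\<close> at place \<open>n + 1\<close>: $1$ stands for the digit
  $0$ and $-1$ for the digit $1$.
\<close>
lemma same_dyadic_interval_iff_same_digits:
  fixes x y :: real
  assumes "x \<in> {0..<1}" "y \<in> {0..<1}"
  shows "\<lfloor>2 ^ m * x\<rfloor> = \<lfloor>2 ^ m * y\<rfloor> \<longleftrightarrow> (\<forall>n<m. R (2 ^ n * x) = R (2 ^ n * y))"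
proof (induction m)
  case 0
  have "\<lfloor>x\<rfloor> = 0" "\<lfloor>y\<rfloor> = 0" using assms by (auto intro: floor_unique)
  then show ?case by simp
next
  case (Suc m)
  let ?d = "\<lambda>x. if R (2 ^ m * x) = 1 then 0 else 1 :: int"
  have fl: "\<lfloor>2 ^ Suc m * u\<rfloor> = 2 * \<lfloor>2 ^ m * u\<rfloor> + ?d u" for u
    using floor_double[of "2 ^ m * u"] by (simp add: mult.assoc)
  have "\<lfloor>2 ^ Suc m * x\<rfloor> = \<lfloor>2 ^ Suc m * y\<rfloor> \<longleftrightarrow> \<lfloor>2 ^ m * x\<rfloor> = \<lfloor>2 ^ m * y\<rfloor> \<and> ?d x = ?d y"
    unfolding fl by auto presburger+
  also have "?d x = ?d y \<longleftrightarrow> R (2 ^ m * x) = R (2 ^ m * y)"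
    using R_cases[of "2 ^ m * x"] R_cases[of "2 ^ m * y"] by auto
  finally show ?case using Suc by (auto simp: less_Suc_eq)
qed

text \<open>
  The second hypothesis excludes the sequences that are eventually $-1$: these would be binary expansions
  ending in ones only, which \<open>R\<close> does not produce.
\<close>
lemma binary_expansion:
  assumes sign: "sign_seq \<epsilon>" and inf: "\<And>N. \<exists>n\<ge>N. \<epsilon> n = 1"
  obtains x :: real where "x \<in> {0..<1}" "\<And>n. R (2 ^ n * x) = \<epsilon> n"
proof -
  define d where "d n = (1 - \<epsilon> n) / 2" for n
  have d: "d n = 0 \<and> \<epsilon> n = 1 \<or> d n = 1 \<and> \<epsilon> n = -1" for n
    using sign unfolding sign_seq_def d_def by (cases "\<epsilon> n = 1") auto
  have d01: "0 \<le> d n" "d n \<le> 1" for n using d[of n] by auto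
  \<comment> \<open>\<open>T n\<close> is the fractional part of \<open>2 ^ n * T 0\<close>.\<close>
  define T where "T n = (\<Sum>k. d (n + k) * (1 / 2) ^ Suc k)" for n
  have geo: "(\<lambda>k. (1 / 2) ^ Suc k) sums (1 :: real)" by (rule power_half_series)
  have le: "d (n + k) * (1 / 2) ^ Suc k \<le> (1 / 2) ^ Suc k" for n k
    using d01[of "n + k"] by (intro mult_left_le_one_le) auto
  have sm: "summable (\<lambda>k. d (n + k) * (1 / 2) ^ Suc k)" for n
    using d01 le by (intro summable_comparison_test'[OF sums_summable[OF geo]]) (simp add: abs_mult)
  have T0: "0 \<le> T n" for n unfolding T_def using d01 sm by (intro suminf_nonneg) auto
  have "T n \<le> (\<Sum>k. (1 / 2) ^ Suc k)" for n
    unfolding T_def by (rule suminf_le[OF le sm sums_summable[OF geo]])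
  then have T1: "T n \<le> 1" for n unfolding sums_unique[OF geo, symmetric] .
  have rec: "T n = (d n + T (Suc n)) / 2" for n
  proof -
    have "T n = d n / 2 + (\<Sum>k. d (n + Suc k) * (1 / 2) ^ Suc (Suc k))"
      unfolding T_def using suminf_split_head[OF sm[of n]] by simp
    also have "(\<Sum>k. d (n + Suc k) * (1 / 2) ^ Suc (Suc k)) = (\<Sum>k. (1 / 2) * (d (Suc n + k) * (1 / 2) ^ Suc k))"
      by (intro suminf_cong) simp
    also have "\<dots> = (1 / 2) * T (Suc n)"
      unfolding T_def by (rule suminf_mult[OF sm])
    finally show ?thesis by simp
  qed
  have lt1: "T n < 1" for n
  proof -
    obtain k where k: "n \<le> k" "\<epsilon> k = 1" using inf by blast
    have "T k < 1" using rec[of k] d[of k] T1[of "Suc k"] k by auto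
    with k(1) show ?thesis
    proof (induction rule: inc_induct)
      case (step j)
      then show ?case using rec[of j] d01[of j] by auto
    qed
  qed
  have int: "2 ^ n * T 0 - T n \<in> \<int>" for n
  proof (induction n)
    case (Suc n)
    have "2 ^ Suc n * T 0 - T (Suc n) = 2 * (2 ^ n * T 0 - T n) + d n"
      using rec[of n] by simp
    moreover have "d n \<in> \<int>" using d[of n] by auto
    ultimately show ?case using Suc by (simp only:) (intro Ints_add Ints_mult, simp_all)
  qed simp
  have "frac (2 ^ n * T 0) = T n" for n
    using int[of n] T0[of n] lt1[of n] by (simp add: frac_unique_iff)
  then have "R (2 ^ n * T 0) = \<epsilon> n" for n
    using rec[of n] d[of n] T0[of "Suc n"] lt1[of "Suc n"] by (auto simp: R_def)
  then show thesis using that[of "T 0"] T0 lt1 by auto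
qed

lemma hausdorff_measure_eq_0_above_1:
  fixes A :: "real set"
  assumes A: "A \<subseteq> {0..<1}" and s: "s > 1"
  shows "hausdorff_measure s A = 0"
proof -
  have "hausdorff_premeasure s d A = 0" if d: "d > 0" for d
  proof -
    have bound: "hausdorff_premeasure s d A \<le> ennreal (real (Suc n) powr (1 - s))" if n: "1 / real (Suc n) \<le> d" for n
    proof -
      define U where "U i = (if i \<le> n then {real i / Suc n .. real (Suc i) / Suc n} else {})" for i
      have len: "real (Suc i) / Suc n - real i / Suc n = 1 / Suc n" for i
        by (simp add: field_simps)
      have ends: "real i / Suc n \<le> real (Suc i) / Suc n" for i
        by (intro divide_right_mono) auto
      have diam: "diameter (U i) = 1 / real (Suc n)" if "i \<le> n" for i
      proof -
        have "U i = {real i / Suc n .. real (Suc i) / Suc n}" using that by (simp only: U_def if_True)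
        then show ?thesis using ends[of i] len[of i] by (simp only: diameter_closed_interval) argo
      qed
      have "A \<subseteq> (\<Union>i. U i)"
      proof
        fix x assume "x \<in> A"
        then have x: "0 \<le> x" "x < 1" using A by auto
        define i where "i = nat \<lfloor>x * Suc n\<rfloor>"
        have i: "real i \<le> x * Suc n" "x * Suc n < real i + 1"
          using x by (auto simp: i_def of_nat_nat)
        have "x * real (Suc n) < 1 * real (Suc n)" using x by (intro mult_strict_right_mono) auto
        from le_less_trans[OF i(1) this] have "i < Suc n" by (simp only: mult_1 of_nat_less_iff)
        then have "i \<le> n" by simp
        moreover have "real i / Suc n \<le> x" "x \<le> real (Suc i) / Suc n"
          using i by (simp_all add: field_simps)
        ultimately show "x \<in> (\<Union>i. U i)" unfolding U_def by (intro UN_I[of i]) auto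
      qed
      moreover have "bounded (U i) \<and> diameter (U i) \<le> d" for i
        using diam[of i] n d by (cases "i \<le> n") (auto simp: U_def)
      ultimately have "hausdorff_premeasure s d A \<le> (\<Sum>i. diam_pow s (U i))"
        unfolding hausdorff_premeasure_def by (intro INF_lower) auto
      also have "\<dots> = (\<Sum>i\<le>n. diam_pow s (U i))"
        by (intro suminf_finite) (auto simp: U_def diam_pow_def)
      also have "\<dots> = (\<Sum>i\<le>n. ennreal ((1 / Suc n) powr s))"
      proof (intro sum.cong refl)
        fix i assume "i \<in> {..n}"
        moreover from this have "U i \<noteq> {}" using ends[of i] by (simp only: U_def atMost_iff if_True atLeastatMost_empty_iff) simp
        ultimately show "diam_pow s (U i) = ennreal ((1 / Suc n) powr s)"
          using s by (simp add: diam_pow_def diam)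
      qed
      also have "\<dots> = ennreal (real (Suc n) * (1 / Suc n) powr s)"
        by (simp add: ennreal_mult ennreal_of_nat_eq_real_of_nat del: of_nat_Suc)
      also have "real (Suc n) * (1 / Suc n) powr s = real (Suc n) powr (1 - s)"
        by (simp add: powr_diff powr_divide powr_one del: of_nat_Suc)
      finally show ?thesis .
    qed
    have "(\<lambda>n. ennreal (real (Suc n) powr (1 - s))) \<longlonglongrightarrow> ennreal 0"
    proof (intro tendsto_ennrealI)
      have "(\<lambda>n. real n powr (1 - s)) \<longlonglongrightarrow> 0"
        using s by (intro tendsto_neg_powr filterlim_real_sequentially) auto
      then show "(\<lambda>n. real (Suc n) powr (1 - s)) \<longlonglongrightarrow> 0" by (rule LIMSEQ_Suc)
    qed
    moreover have "\<exists>N. \<forall>n\<ge>N. hausdorff_premeasure s d A \<le> ennreal (real (Suc n) powr (1 - s))"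
    proof -
      obtain N :: nat where N: "1 / d < real N" using reals_Archimedean2 by blast
      have "1 / real (Suc n) \<le> d" if "n \<ge> N" for n
      proof -
        have "1 / d \<le> real (Suc n)" using N that by simp
        then show ?thesis using d by (simp add: field_simps)
      qed
      then show ?thesis using bound by blast
    qed
    ultimately have "hausdorff_premeasure s d A \<le> ennreal 0" by (rule LIMSEQ_le_const)
    then show ?thesis by simp
  qed
  then show ?thesis unfolding hausdorff_measure_def by (simp add: SUP_eq_const)
qed

lemma hausdorff_dim_eq_1I:
  fixes A :: "real set"
  assumes A: "A \<subseteq> {0..<1}" and pos: "\<And>s. 0 \<le> s \<Longrightarrow> s < 1 \<Longrightarrow> hausdorff_measure s A \<noteq> 0"
  shows "hausdorff_dim A = 1"
proof (rule antisym)
  show "hausdorff_dim A \<le> 1"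
  proof (rule ennreal_le_epsilon)
    fix e :: real assume e: "e > 0"
    have "hausdorff_dim A \<le> ennreal (1 + e)"
      unfolding hausdorff_dim_def using hausdorff_measure_eq_0_above_1[OF A, of "1 + e"] e
      by (intro Inf_lower) fastforce
    also have "\<dots> = 1 + ennreal e" using e by (simp add: ennreal_plus)
    finally show "hausdorff_dim A \<le> 1 + ennreal e" .
  qed
  show "1 \<le> hausdorff_dim A"
    unfolding hausdorff_dim_def
  proof (rule Inf_greatest)
    fix t assume "t \<in> {ennreal s | s. 0 \<le> s \<and> hausdorff_measure s A = 0}"
    then obtain s where s: "t = ennreal s" "0 \<le> s" "hausdorff_measure s A = 0" by auto
    then have "1 \<le> s" using pos not_less by blast
    then show "1 \<le> t" using s(1) ennreal_leI[of 1 s] by simp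
  qed
qed

text \<open>
  A mass distribution argument for a set that contains a coded copy of the unit interval: \<open>m * L\<close> digits
  of the point \<open>h y\<close> determine \<open>m * f\<close> digits of the parameter \<open>y\<close>. A set \<open>U\<close> of diameter about \<open>2 ^ (- m * L)\<close> meets at most
  three dyadic intervals of that length, so its parameters lie in three intervals of length \<open>2 ^ (- m * f)\<close>, whose total
  length is at most a constant times the power \<open>f / L\<close> of the diameter. Since a cover of \<open>E\<close> yields a cover of all
  parameters, the sums of powers of diameters are bounded below.
\<close>
lemma hausdorff_measure_pos_of_coding:
  fixes E :: "real set" and h :: "real \<Rightarrow> real"
  assumes h: "\<And>y. y \<in> {0..<1} \<Longrightarrow> h y \<in> E"
    and code: "\<And>m y y'. y \<in> {0..<1} \<Longrightarrow> y' \<in> {0..<1} \<Longrightarrow>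
      \<lfloor>2 ^ (m * L) * h y\<rfloor> = \<lfloor>2 ^ (m * L) * h y'\<rfloor> \<Longrightarrow> \<lfloor>2 ^ (m * f) * y\<rfloor> = \<lfloor>2 ^ (m * f) * y'\<rfloor>"
    and L: "L > 0" and f: "f > 0" and s: "0 \<le> s" "s \<le> real f / real L"
  shows "hausdorff_measure s E \<noteq> 0"
proof -
  define A where "A U = {y \<in> {0..<1}. h y \<in> U}" for U
  have cover: "\<exists>V. V \<in> sets lborel \<and> A U \<subseteq> V \<and> emeasure lborel V \<le> ennreal (3 / 2 ^ (m * f))"
    if U: "bounded U" "diameter U \<le> 1 / 2 ^ (m * L)" for U m
  proof (cases "A U = {}")
    case True
    then show ?thesis by (intro exI[of _ "{}"]) auto
  next
    case False
    then obtain y0 where y0: "y0 \<in> A U" by blast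
    define p q :: real where "p = 2 ^ (m * L)" and "q = 2 ^ (m * f)"
    have pq: "p > 0" "q > 0" by (simp_all add: p_def q_def)
    define k0 where "k0 = \<lfloor>p * h y0\<rfloor>"
    define W where "W k y \<longleftrightarrow> y \<in> A U \<and> \<lfloor>p * h y\<rfloor> = k" for k y
    \<comment> \<open>All parameters in class \<open>k\<close> lie in the same dyadic interval, so any of them gives its number.\<close>
    define i where "i k = \<lfloor>q * (SOME y. W k y)\<rfloor>" for k
    define V where "V k = {of_int (i k) / q .. of_int (i k + 1) / q}" for k
    have W: "y \<in> V k" if "W k y" for k y
    proof -
      define y' where "y' = (SOME y. W k y)"
      have "W k y'" unfolding y'_def using that by (rule someI)
      then have "\<lfloor>q * y\<rfloor> = \<lfloor>q * y'\<rfloor>"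
        using that code[of y y' m] by (simp add: W_def A_def p_def q_def)
      then have "\<lfloor>q * y\<rfloor> = i k" by (simp add: i_def y'_def)
      then have "of_int (i k) \<le> q * y" "q * y \<le> of_int (i k + 1)" by linarith+
      then show ?thesis using pq by (auto simp: V_def field_simps)
    qed
    have "A U \<subseteq> V (k0 - 1) \<union> (V k0 \<union> V (k0 + 1))"
    proof
      fix y assume y: "y \<in> A U"
      have "\<bar>h y - h y0\<bar> \<le> 1 / p"
        using diameter_bounded_bound[OF U(1), of "h y" "h y0"] y y0 U(2)
        by (simp add: A_def dist_real_def p_def)
      then have "p * \<bar>h y - h y0\<bar> \<le> p * (1 / p)" using pq by (intro mult_left_mono) auto
      moreover have "\<bar>p * h y - p * h y0\<bar> = p * \<bar>h y - h y0\<bar>"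
        using pq by (simp add: abs_mult flip: right_diff_distrib)
      ultimately have "\<bar>p * h y - p * h y0\<bar> \<le> 1" using pq by simp
      then have "\<lfloor>p * h y\<rfloor> \<in> {k0 - 1, k0, k0 + 1}" unfolding k0_def by simp linarith
      moreover have "y \<in> V \<lfloor>p * h y\<rfloor>" using W[of "\<lfloor>p * h y\<rfloor>" y] y by (simp add: W_def)
      ultimately show "y \<in> V (k0 - 1) \<union> (V k0 \<union> V (k0 + 1))" by auto
    qed
    moreover have "emeasure lborel (V (k0 - 1) \<union> (V k0 \<union> V (k0 + 1))) \<le> ennreal (3 / q)"
    proof -
      have e: "emeasure lborel (V k) = ennreal (1 / q)" for k
        using pq by (simp add: V_def add_divide_distrib)
      have "emeasure lborel (V (k0 - 1) \<union> (V k0 \<union> V (k0 + 1)))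
          \<le> emeasure lborel (V (k0 - 1)) + emeasure lborel (V k0 \<union> V (k0 + 1))"
        by (intro emeasure_subadditive) (auto simp: V_def)
      also have "\<dots> \<le> emeasure lborel (V (k0 - 1)) + (emeasure lborel (V k0) + emeasure lborel (V (k0 + 1)))"
        by (intro add_left_mono emeasure_subadditive) (auto simp: V_def)
      also have "\<dots> = ennreal (1 / q + (1 / q + 1 / q))"
        unfolding e using pq by (simp only: ennreal_plus zero_le_divide_1_iff add_nonneg_nonneg less_imp_le)
      also have "1 / q + (1 / q + 1 / q) = 3 / q" by simp
      finally show ?thesis .
    qed
    ultimately show ?thesis unfolding q_def
      by (intro exI[of _ "V (k0 - 1) \<union> (V k0 \<union> V (k0 + 1))"]) (auto simp: V_def)
  qed
  define K :: real where "K = 3 * 2 ^ f"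
  have K: "K > 0" by (simp add: K_def)
  have cover_pow: "\<exists>V. V \<in> sets lborel \<and> A U \<subseteq> V \<and> emeasure lborel V \<le> ennreal K * diam_pow s U"
    if U: "bounded U" "diameter U \<le> 1" for U
  proof (cases "U = {}")
    case True
    then show ?thesis by (intro exI[of _ "{}"]) (auto simp: A_def)
  next
    case nonempty: False
    have d0: "0 \<le> diameter U" using U(1) by (rule diameter_ge_0)
    consider "diameter U > 0" | "diameter U = 0" "s = 0" | "diameter U = 0" "s > 0"
      using d0 s(1) by fastforce
    then show ?thesis
    proof cases
      case 1
      define d where "d = diameter U"
      have d: "0 < d" "d \<le> 1" using 1 U by (auto simp: d_def)
      have ex: "\<exists>m. 1 / 2 ^ (Suc m * L) < d"
      proof -
        obtain m where "(1 / 2 ^ L) ^ m < d"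
          using real_arch_pow_inv[of d "1 / 2 ^ L"] d L by (auto simp: divide_less_eq)
        moreover have "(1 / 2 ^ L :: real) ^ Suc m \<le> (1 / 2 ^ L) ^ m"
          by (intro power_decreasing) auto
        ultimately show ?thesis
          by (intro exI[of _ m]) (simp only: power_divide power_one power_mult[symmetric] mult.commute)
      qed
      define m where "m = (LEAST m. 1 / 2 ^ (Suc m * L) < d)"
      have m1: "1 / 2 ^ (Suc m * L) < d" unfolding m_def using ex by (rule LeastI_ex)
      have m2: "d \<le> 1 / 2 ^ (m * L)"
      proof (cases m)
        case 0
        then show ?thesis using d by simp
      next
        case (Suc j)
        then have "\<not> 1 / 2 ^ (Suc j * L) < d" unfolding m_def by (intro not_less_Least) simp
        then show ?thesis using Suc by simp
      qed
      obtain V where V: "V \<in> sets lborel" "A U \<subseteq> V" "emeasure lborel V \<le> ennreal (3 / 2 ^ (m * f))"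
        using cover[OF U(1), of m] m2 by (auto simp: d_def)
      have "1 / 2 ^ (Suc m * f) = (1 / 2 ^ (Suc m * L)) powr (real f / real L)"
      proof -
        have "real (Suc m * L) * (real f / real L) = real (Suc m * f)"
          using L by (simp add: field_simps)
        then show ?thesis
          by (simp only: powr_divide powr_one_eq_one powr_realpow[symmetric] powr_powr zero_less_numeral)
      qed
      also have "\<dots> \<le> d powr (real f / real L)" using m1 by (intro powr_mono2) auto
      also have "\<dots> \<le> d powr s" using d s by (intro powr_mono') auto
      finally have "K * (1 / 2 ^ (Suc m * f)) \<le> K * d powr s" using K by (intro mult_left_mono) auto
      also have "K * (1 / 2 ^ (Suc m * f)) = 3 / 2 ^ (m * f)" by (simp add: K_def power_add)
      finally have "ennreal (3 / 2 ^ (m * f)) \<le> ennreal K * ennreal (d powr s)"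
        using K by (subst ennreal_mult[symmetric]) (auto intro: ennreal_leI)
      also have "ennreal (d powr s) = diam_pow s U" using nonempty d by (simp add: diam_pow_def d_def)
      finally show ?thesis using V order_trans by blast
    next
      case 2
      obtain V where V: "V \<in> sets lborel" "A U \<subseteq> V" "emeasure lborel V \<le> ennreal 3"
        using cover[OF U(1), of 0] 2 by auto
      have "ennreal 3 \<le> ennreal K * diam_pow s U"
        using 2 nonempty by (simp add: diam_pow_def K_def ennreal_leI)
      then show ?thesis using V order_trans by blast
    next
      case 3
      \<comment> \<open>A set of diameter $0$ can be covered at every scale \<open>m\<close>, so its parameters form a null set.\<close>
      have "\<forall>m. \<exists>V. V \<in> sets lborel \<and> A U \<subseteq> V \<and> emeasure lborel V \<le> ennreal (3 / 2 ^ (m * f))"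
        using cover[OF U(1)] 3 by auto
      then obtain V where V: "\<And>m. V m \<in> sets lborel" "\<And>m. A U \<subseteq> V m"
        "\<And>m. emeasure lborel (V m) \<le> ennreal (3 / 2 ^ (m * f))" by metis
      have meas: "(\<Inter>m. V m) \<in> sets lborel" using V(1) by (intro sets.countable_INT'') auto
      have le: "emeasure lborel (\<Inter>m. V m) \<le> ennreal (3 / (2 ^ f) ^ m)" for m
        using emeasure_mono[OF _ V(1)[of m], of "\<Inter>m. V m"] V(3)[of m]
        by (auto simp: power_mult[symmetric] mult.commute intro: order_trans)
      have "(\<lambda>m. ennreal (3 / (2 ^ f) ^ m)) \<longlonglongrightarrow> ennreal 0"
        using f by (intro tendsto_ennrealI LIMSEQ_divide_realpow_zero) simp
      then have "emeasure lborel (\<Inter>m. V m) \<le> ennreal 0"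
        by (rule LIMSEQ_le_const) (use le in blast)
      then show ?thesis using meas V(2) by (intro exI[of _ "\<Inter>m. V m"]) auto
    qed
  qed
  have "ennreal (1 / K) \<le> hausdorff_premeasure s 1 E"
    unfolding hausdorff_premeasure_def
  proof (rule INF_greatest)
    fix U :: "nat \<Rightarrow> real set"
    assume "U \<in> {U. E \<subseteq> (\<Union>i. U i) \<and> (\<forall>i. bounded (U i) \<and> diameter (U i) \<le> 1)}"
    then have U: "E \<subseteq> (\<Union>i. U i)" "\<And>i. bounded (U i)" "\<And>i. diameter (U i) \<le> 1" by auto
    have "\<forall>i. \<exists>V. V \<in> sets lborel \<and> A (U i) \<subseteq> V \<and> emeasure lborel V \<le> ennreal K * diam_pow s (U i)"
      using cover_pow U by blast
    then obtain V where V: "\<And>i. V i \<in> sets lborel" "\<And>i. A (U i) \<subseteq> V i"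
      "\<And>i. emeasure lborel (V i) \<le> ennreal K * diam_pow s (U i)" by metis
    have sub: "{0..<1} \<subseteq> (\<Union>i. V i)"
    proof
      fix y :: real assume "y \<in> {0..<1}"
      then obtain i where "y \<in> A (U i)" using h U(1) by (auto simp: A_def)
      then show "y \<in> (\<Union>i. V i)" using V(2) by blast
    qed
    have "1 = emeasure lborel {0..<1::real}" by simp
    also have "\<dots> \<le> emeasure lborel (\<Union>i. V i)" using V(1) by (intro emeasure_mono sub) auto
    also have "\<dots> \<le> (\<Sum>i. emeasure lborel (V i))" using V(1) by (intro emeasure_subadditive_countably) auto
    also have "\<dots> \<le> (\<Sum>i. ennreal K * diam_pow s (U i))" using V(3) by (intro suminf_le) auto
    also have "\<dots> = ennreal K * (\<Sum>i. diam_pow s (U i))" by simp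
    finally have "ennreal (1 / K) * 1 \<le> ennreal (1 / K) * (ennreal K * (\<Sum>i. diam_pow s (U i)))"
      by (rule mult_left_mono) simp
    also have "\<dots> = ennreal (1 / K * K) * (\<Sum>i. diam_pow s (U i))"
      using K by (simp add: ennreal_mult mult.assoc del: nonzero_divide_eq_eq times_divide_eq_left)
    finally show "ennreal (1 / K) \<le> (\<Sum>i. diam_pow s (U i))" using K by simp
  qed
  also have "\<dots> \<le> hausdorff_measure s E"
    unfolding hausdorff_measure_def by (rule SUP_upper) simp
  finally have "ennreal (1 / K) \<le> hausdorff_measure s E" .
  moreover have "ennreal (1 / K) > 0" using K by simp
  ultimately show ?thesis by (metis leD)
qed

section \<open>Free digits in blocks\<close>

lemma sum_blocks: "(\<Sum>n<J * L. f n) = (\<Sum>j<J. \<Sum>i<L. f (j * L + i))"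
  for f :: "nat \<Rightarrow> 'a::comm_monoid_add"
proof -
  have "(\<Sum>n\<in>{j * L..<j * L + L}. f n) = (\<Sum>i<L. f (j * L + i))" for j
    by (rule sum.reindex_bij_witness[of _ "\<lambda>i. j * L + i" "\<lambda>n. n - j * L"]) auto
  then show ?thesis by (simp add: sum.nat_group[symmetric])
qed

lemma block_norms_tendsto_0:
  fixes c :: "nat \<Rightarrow> complex"
  assumes "c \<longlonglongrightarrow> 0" "L > 0"
  shows "(\<lambda>j. \<Sum>i<L. norm (c (j * L + i))) \<longlonglongrightarrow> 0"
proof (rule tendsto_null_sum)
  fix i
  have "strict_mono (\<lambda>j. j * L + i)" using assms by (auto simp: strict_mono_def)
  from LIMSEQ_subseq_LIMSEQ[OF assms(1) this] show "(\<lambda>j. norm (c (j * L + i))) \<longlonglongrightarrow> 0"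
    by (simp add: tendsto_norm_zero o_def)
qed

text \<open>
  Within each block of \<open>L\<close> indices the pattern \<open>\<phi>\<close> is prescribed up to one sign for each of three classes of
  positions. Choosing these signs amounts to choosing signs for the sequence \<open>z\<close> of class sums, three per block. As the
  terms of a block tend to $0$ in total, convergence along the ends of blocks is convergence of the series.
\<close>
lemma signs_from_block_classes:
  fixes c :: "nat \<Rightarrow> complex" and \<phi> :: "nat \<Rightarrow> real" and cls :: "nat \<Rightarrow> nat"
  assumes c0: "c \<longlonglongrightarrow> 0" and L: "L > 0" and \<phi>: "sign_seq \<phi>" and cls: "\<And>i. i < L \<Longrightarrow> cls i < 3"
    and target: "\<And>z. z \<longlonglongrightarrow> 0 \<Longrightarrow>
       (\<And>j k. k < 3 \<Longrightarrow> z (j * 3 + k) = (\<Sum>i\<in>{i\<in>{..<L}. cls i = k}. \<phi> (j * L + i) *\<^sub>R c (j * L + i))) \<Longrightarrow>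
       \<exists>\<tau> w. sign_seq \<tau> \<and> w \<in> W \<and> (\<lambda>n. \<tau> n *\<^sub>R z n) sums w"
  shows "\<exists>\<tau> w. sign_seq \<tau> \<and> w \<in> W \<and>
    (\<lambda>n. (\<tau> (n div L * 3 + cls (n mod L)) * \<phi> n) *\<^sub>R c n) sums w"
proof -
  define u where "u j = (\<Sum>i<L. norm (c (j * L + i)))" for j
  have u0: "u \<longlonglongrightarrow> 0" unfolding u_def[abs_def] by (rule block_norms_tendsto_0[OF c0 L])
  have \<phi>1: "\<bar>\<phi> n\<bar> = 1" for n using \<phi> by (auto simp: sign_seq_def dest: spec[of _ n])
  define z where "z m = (\<Sum>i\<in>{i\<in>{..<L}. cls i = m mod 3}. \<phi> (m div 3 * L + i) *\<^sub>R c (m div 3 * L + i))" for m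
  have "norm (z m) \<le> u (m div 3)" for m
  proof -
    have "norm (z m) \<le> (\<Sum>i\<in>{i\<in>{..<L}. cls i = m mod 3}. norm (c (m div 3 * L + i)))"
      unfolding z_def by (intro sum_norm_le) (simp add: \<phi>1)
    also have "\<dots> \<le> u (m div 3)" unfolding u_def by (intro sum_mono2) auto
    finally show ?thesis .
  qed
  moreover have "(\<lambda>m. u (m div 3)) \<longlonglongrightarrow> 0"
  proof (rule filterlim_compose[OF u0])
    show "filterlim (\<lambda>m::nat. m div 3) at_top at_top"
      unfolding filterlim_at_top
    proof
      fix Z :: nat
      show "\<forall>\<^sub>F m in at_top. Z \<le> m div 3"
        using eventually_ge_at_top[of "Z * 3"] by eventually_elim (simp add: less_eq_div_iff_mult_less_eq)
    qed
  qed
  ultimately have z0: "z \<longlonglongrightarrow> 0"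
    by (intro Lim_null_comparison[of z "\<lambda>m. u (m div 3)"]) auto
  have zk: "z (j * 3 + k) = (\<Sum>i\<in>{i\<in>{..<L}. cls i = k}. \<phi> (j * L + i) *\<^sub>R c (j * L + i))"
    if "k < 3" for j k
    using that by (simp add: z_def)
  obtain \<tau> w where \<tau>: "sign_seq \<tau>" "w \<in> W" "(\<lambda>n. \<tau> n *\<^sub>R z n) sums w"
    using target[OF z0 zk] by blast
  have \<tau>1: "\<bar>\<tau> n\<bar> = 1" for n using \<tau>(1) by (auto simp: sign_seq_def dest: spec[of _ n])
  define \<epsilon> where "\<epsilon> n = \<tau> (n div L * 3 + cls (n mod L)) * \<phi> n" for n
  define S where "S m = (\<Sum>n<m. \<epsilon> n *\<^sub>R c n)" for m
  have \<epsilon>_block: "\<epsilon> (j * L + i) = \<tau> (j * 3 + cls i) * \<phi> (j * L + i)" if "i < L" for i j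
    using that by (simp add: \<epsilon>_def)
  have block: "(\<Sum>i<L. \<epsilon> (j * L + i) *\<^sub>R c (j * L + i)) = (\<Sum>k<3. \<tau> (j * 3 + k) *\<^sub>R z (j * 3 + k))" for j
  proof -
    have "(\<Sum>i<L. \<epsilon> (j * L + i) *\<^sub>R c (j * L + i))
        = (\<Sum>k<3. \<Sum>i\<in>{i\<in>{..<L}. cls i = k}. \<epsilon> (j * L + i) *\<^sub>R c (j * L + i))"
      by (rule sum.group[symmetric]) (use cls in auto)
    also have "\<dots> = (\<Sum>k<3. \<tau> (j * 3 + k) *\<^sub>R z (j * 3 + k))"
      by (intro sum.cong refl) (simp add: zk \<epsilon>_block scaleR_sum_right)
    finally show ?thesis .
  qed
  have "S (J * L) = (\<Sum>m<J * 3. \<tau> m *\<^sub>R z m)" for J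
    unfolding S_def sum_blocks block ..
  moreover have "(\<lambda>J. \<Sum>m<J * 3. \<tau> m *\<^sub>R z m) \<longlonglongrightarrow> w"
    using LIMSEQ_subseq_LIMSEQ[of "\<lambda>J. \<Sum>m<J. \<tau> m *\<^sub>R z m" w "\<lambda>J. J * 3"] \<tau>(3)
    by (auto simp: sums_def strict_mono_def o_def)
  ultimately have lim: "(\<lambda>J. S (J * L)) \<longlonglongrightarrow> w" by simp
  have "strict_mono (\<lambda>J. J * L)" using L by (auto simp: strict_mono_def)
  then have "S \<longlonglongrightarrow> w"
  proof (rule tendsto_from_cuts[of "\<lambda>J. J * L" S w u, OF _ lim u0])
    fix J m assume m: "J * L \<le> m" "m \<le> Suc J * L"
    have "S m - S (J * L) = (\<Sum>n\<in>{J * L..<m}. \<epsilon> n *\<^sub>R c n)"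
      using m(1) sum.atLeastLessThan_concat[of 0 "J * L" m "\<lambda>n. \<epsilon> n *\<^sub>R c n"]
      by (simp add: atLeast0LessThan S_def algebra_simps)
    also have "norm \<dots> \<le> (\<Sum>n\<in>{J * L..<m}. norm (c n))"
      using \<phi>1 \<tau>1 by (intro sum_norm_le) (simp add: \<epsilon>_def abs_mult)
    also have "\<dots> \<le> (\<Sum>n\<in>{J * L..<J * L + L}. norm (c n))"
      using m by (intro sum_mono2) auto
    also have "\<dots> = u J"
      unfolding u_def by (rule sum.reindex_bij_witness[of _ "\<lambda>i. J * L + i" "\<lambda>n. n - J * L"]) auto
    finally show "norm (S m - S (J * L)) \<le> u J" .
  qed
  then have "(\<lambda>n. \<epsilon> n *\<^sub>R c n) sums w" unfolding S_def[abs_def] sums_def .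
  with \<tau>(1,2) show ?thesis unfolding \<epsilon>_def by blast
qed

lemma nonsummable_mono_subseq:
  fixes f g :: "nat \<Rightarrow> real"
  assumes "\<And>n. 0 \<le> f n" "inj \<rho>" "\<not> summable (\<lambda>j. f (\<rho> j))"
  shows "\<not> summable f"
  using summable_reindex[of f \<rho>] assms by (auto simp: o_def)

text \<open>
  The dimension criterion. In each block of \<open>L\<close> indices, two control positions \<open>r\<close>, \<open>r'\<close> receive signs of
  their own, and all other positions share a common sign. Relative to the digit at a reference position \<open>q\<close>, the digits at
  the remaining \<open>L - 4\<close> positions are free; they carry the digits of a parameter \<open>y\<close>. The control terms alone make the
  sequence of class sums satisfy the non-summability condition \<open>H\<close>, so that \<open>target\<close> provides signs whatever the free
  digits are. Position \<open>q'\<close> always has the digit opposite to that at \<open>q\<close>, which prevents the expansion from being constant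
  from some place on. Thus \<open>m * (L - 4)\<close> digits of the parameter are read off from \<open>m * L\<close> digits of the point, and the dimension
  is at least \<open>(L - 4) / L\<close> for every \<open>L\<close>.
\<close>
theorem hausdorff_dim_sign_series:
  fixes c :: "nat \<Rightarrow> complex" and H :: "complex \<Rightarrow> complex \<Rightarrow> real"
  assumes c0: "c \<longlonglongrightarrow> 0" and H0: "\<And>g v. 0 \<le> H g v"
    and control: "\<And>L. L \<ge> 5 \<Longrightarrow> \<exists>r<L. \<exists>r'<L. \<forall>g. norm g = 1 \<longrightarrow>
        \<not> summable (\<lambda>j. H g (c (j * L + r))) \<or> \<not> summable (\<lambda>j. H g (c (j * L + r')))"
    and target: "\<And>z. z \<longlonglongrightarrow> 0 \<Longrightarrow> (\<And>g. norm g = 1 \<Longrightarrow> \<not> summable (\<lambda>n. H g (z n))) \<Longrightarrow>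
        \<exists>\<epsilon> w. sign_seq \<epsilon> \<and> w \<in> W \<and> (\<lambda>n. \<epsilon> n *\<^sub>R z n) sums w"
  shows "hausdorff_dim {x \<in> {0..<1::real}. \<exists>w\<in>W. (\<lambda>n. c n * of_real (R (2 ^ n * x))) sums w} = 1"
proof (rule hausdorff_dim_eq_1I)
  let ?E = "{x \<in> {0..<1::real}. \<exists>w\<in>W. (\<lambda>n. c n * of_real (R (2 ^ n * x))) sums w}"
  show "?E \<subseteq> {0..<1}" by auto
  fix s :: real assume s: "0 \<le> s" "s < 1"
  obtain L0 :: nat where L0: "4 / (1 - s) < real L0" using reals_Archimedean2 by blast
  \<comment> \<open>Large enough that \<open>s \<le> (L - 4) / L\<close>.\<close>
  define L where "L = max 5 L0"
  have L: "L \<ge> 5" by (simp add: L_def)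
  define f where "f = L - 4"
  have f: "f > 0" using L by (simp add: f_def)
  have "4 / (1 - s) \<le> real L" using L0 by (simp add: L_def)
  then have "s * real L \<le> real f"
    using s L by (simp add: field_simps f_def of_nat_diff)
  then have sfL: "s \<le> real f / real L" using L by (simp add: field_simps)
  obtain r1 r2 where r12: "r1 < L" "r2 < L" "\<And>g. norm g = 1 \<Longrightarrow>
        \<not> summable (\<lambda>j. H g (c (j * L + r1))) \<or> \<not> summable (\<lambda>j. H g (c (j * L + r2)))"
    using control[OF L] by blast
  obtain r r' where r: "r < L" "r' < L" "r \<noteq> r'" "r1 \<in> {r, r'}" "r2 \<in> {r, r'}"
  proof (cases "r1 = r2")
    case True
    have "(if r1 = 0 then 1 else 0) < L" "r1 \<noteq> (if r1 = 0 then 1 else 0)" using L by auto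
    then show thesis using that[of r1 "if r1 = 0 then 1 else 0"] True r12(1) by auto
  next
    case False
    then show thesis using that[of r1 r2] r12(1,2) by auto
  qed
  have "card ({..<L} - {r, r'}) \<ge> 2" using r L by (simp add: card_Diff_subset)
  then obtain q q' where q: "q < L" "q' < L" "q \<noteq> q'" "q \<notin> {r, r'}" "q' \<notin> {r, r'}"
    by (auto simp: card_le_Suc_iff numeral_2_eq_2)
  define F where "F = {..<L} - {r, r', q, q'}"
  have "card F = f" using r q by (simp add: F_def f_def card_Diff_subset)
  then obtain e where e: "bij_betw e F {..<f}"
    using ex_bij_betw_finite_nat[of F] by (auto simp: F_def atLeast0LessThan)
  define free where "free y n = (if n mod L \<in> F then R (2 ^ (n div L * f + e (n mod L)) * y)
      else if n mod L = q' then -1 else 1)" for y n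
  have free_block: "free y (j * L + i) = (if i \<in> F then R (2 ^ (j * f + e i) * y) else if i = q' then -1 else 1)"
    if "i < L" for y i j
    using that by (simp add: free_def)
  have sign_free: "sign_seq (free y)" for y
    using R_cases by (auto simp: sign_seq_def free_def)
  define cls where "cls i = (if i = r then 0 else if i = r' then 1 else 2::nat)" for i
  define P where "P y x \<longleftrightarrow> x \<in> ?E \<and> (\<forall>j. \<forall>i\<in>F. R (2 ^ (j * L + i) * x) = R (2 ^ (j * L + q) * x) * free y (j * L + i))"
    for y x
  have "\<exists>x. P y x" for y
  proof -
    have fit: "\<exists>\<tau> w. sign_seq \<tau> \<and> w \<in> W \<and> (\<lambda>n. \<tau> n *\<^sub>R z n) sums w"
      if z0: "z \<longlonglongrightarrow> 0" and z: "\<And>j k. k < 3 \<Longrightarrow>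
        z (j * 3 + k) = (\<Sum>i\<in>{i\<in>{..<L}. cls i = k}. free y (j * L + i) *\<^sub>R c (j * L + i))" for z
    proof (rule target[OF z0])
      fix g :: complex assume g: "norm g = 1"
      have "{i\<in>{..<L}. cls i = 0} = {r}" "{i\<in>{..<L}. cls i = 1} = {r'}"
        using r by (auto simp: cls_def split: if_splits)
      then have zr: "z (j * 3 + 0) = c (j * L + r)" "z (j * 3 + 1) = c (j * L + r')" for j
        using z[of 0 j] z[of 1 j] r q by (simp_all add: free_block F_def)
      have "\<not> summable (\<lambda>j. H g (z (j * 3 + 0))) \<or> \<not> summable (\<lambda>j. H g (z (j * 3 + 1)))"
        unfolding zr using r12(3)[OF g] r(4,5) by auto
      then show "\<not> summable (\<lambda>n. H g (z n))"
        using nonsummable_mono_subseq[of "\<lambda>n. H g (z n)" "\<lambda>j. j * 3 + 0"]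
          nonsummable_mono_subseq[of "\<lambda>n. H g (z n)" "\<lambda>j. j * 3 + 1"] H0
        by (auto simp: inj_def)
    qed
    have L0: "L > 0" and cls3: "\<And>i. i < L \<Longrightarrow> cls i < 3" using L by (auto simp: cls_def)
    obtain \<tau> w where \<tau>: "sign_seq \<tau>" "w \<in> W"
      "(\<lambda>n. (\<tau> (n div L * 3 + cls (n mod L)) * free y n) *\<^sub>R c n) sums w"
      using signs_from_block_classes[of c L "free y" cls W, OF c0 L0 sign_free cls3 fit] by blast
    define \<epsilon> where "\<epsilon> n = \<tau> (n div L * 3 + cls (n mod L)) * free y n" for n
    have \<epsilon>_block: "\<epsilon> (j * L + i) = \<tau> (j * 3 + cls i) * free y (j * L + i)" if "i < L" for i j
      using that by (simp add: \<epsilon>_def)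
    have \<epsilon>: "sign_seq \<epsilon>"
      using \<tau>(1) sign_free[of y] unfolding sign_seq_def \<epsilon>_def
      by (metis insert_iff mult_1 mult_minus1 minus_minus empty_iff)
    have cq: "cls q = 2" "cls q' = 2" "q \<notin> F" "q' \<notin> F" using q by (auto simp: cls_def F_def)
    have \<epsilon>q: "\<epsilon> (j * L + q) = \<tau> (j * 3 + 2)" "\<epsilon> (j * L + q') = - \<tau> (j * 3 + 2)" for j
      using q cq by (simp_all add: \<epsilon>_block free_block)
    have "\<exists>n\<ge>N. \<epsilon> n = 1" for N
    proof -
      have "N * L + i \<ge> N" for i using L by (simp add: trans_le_add1)
      moreover have "\<epsilon> (N * L + q) = 1 \<or> \<epsilon> (N * L + q') = 1"
        using \<tau>(1) unfolding \<epsilon>q sign_seq_def by (auto dest: spec[of _ "N * 3 + 2"])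
      ultimately show ?thesis by blast
    qed
    with \<epsilon> obtain x where x: "x \<in> {0..<1}" "\<And>n. R (2 ^ n * x) = \<epsilon> n"
      by (rule binary_expansion) blast
    have "(\<lambda>n. c n * of_real (R (2 ^ n * x))) sums w"
      using \<tau>(3) unfolding x(2) \<epsilon>_def by (simp add: scaleR_conv_of_real mult.commute)
    moreover have "R (2 ^ (j * L + i) * x) = R (2 ^ (j * L + q) * x) * free y (j * L + i)" if "i \<in> F" for i j
      using that unfolding x(2) \<epsilon>q by (auto simp: \<epsilon>_block F_def cls_def)
    ultimately show ?thesis using x(1) \<tau>(2) unfolding P_def by blast
  qed
  then obtain h where h: "\<And>y. P y (h y)" by metis
  have code: "\<lfloor>2 ^ (m * f) * y\<rfloor> = \<lfloor>2 ^ (m * f) * y'\<rfloor>"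
    if y: "y \<in> {0..<1}" "y' \<in> {0..<1}" and eq: "\<lfloor>2 ^ (m * L) * h y\<rfloor> = \<lfloor>2 ^ (m * L) * h y'\<rfloor>" for m y y'
  proof -
    have digits: "R (2 ^ n * h y) = R (2 ^ n * h y')" if "n < m * L" for n
      using same_dyadic_interval_iff_same_digits[of "h y" "h y'" "m * L"] eq h[of y] h[of y'] that
      by (auto simp: P_def)
    have "R (2 ^ k * y) = R (2 ^ k * y')" if k: "k < m * f" for k
    proof -
      define j where "j = k div f"
      have "k mod f < f" "j < m" using k f by (simp_all add: j_def less_mult_imp_div_less)
      then obtain i where i: "i \<in> F" "e i = k mod f"
        using e by (metis bij_betw_iff_bijections lessThan_iff)
      have "i < L" using i by (simp add: F_def)
      have free_y: "free u (j * L + i) = R (2 ^ k * u)" for u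
        using i \<open>i < L\<close> by (simp add: free_block j_def)
      have "j * L + a < m * L" if "a < L" for a
      proof -
        have "j * L + a < Suc j * L" using that by simp
        also have "\<dots> \<le> m * L" using \<open>j < m\<close> by (intro mult_right_mono) auto
        finally show ?thesis .
      qed
      then have "R (2 ^ (j * L + i) * h y) = R (2 ^ (j * L + i) * h y')"
        "R (2 ^ (j * L + q) * h y) = R (2 ^ (j * L + q) * h y')"
        using digits \<open>i < L\<close> q(1) by blast+
      moreover have "R (2 ^ (j * L + i) * h u) = R (2 ^ (j * L + q) * h u) * R (2 ^ k * u)" for u
        using h[of u] i(1) unfolding P_def free_y[symmetric] by blast
      moreover have "R (2 ^ (j * L + q) * h y) \<noteq> 0" using R_cases[of "2 ^ (j * L + q) * h y"] by auto
      ultimately show ?thesis by (metis mult_cancel_left)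
    qed
    then show ?thesis using same_dyadic_interval_iff_same_digits[OF y] by blast
  qed
  have hE: "h y \<in> ?E" for y using h[of y] by (simp only: P_def)
  have "L > 0" using L by simp
  from hausdorff_measure_pos_of_coding[of h ?E L f s, OF hE code this f s(1) sfL]
  show "hausdorff_measure s ?E \<noteq> 0" .
qed

section \<open>Ratios, linear non-summability and residue classes\<close>

lemma nonsummable_residue_class:
  fixes f :: "nat \<Rightarrow> real"
  assumes f0: "\<And>n. 0 \<le> f n" and f: "\<not> summable f" and L: "L > 0"
  obtains r where "r < L" "\<not> summable (\<lambda>j. f (j * L + r))"
proof (rule ccontr)
  assume "\<not> thesis"
  with that have sm: "\<And>r. r < L \<Longrightarrow> summable (\<lambda>j. f (j * L + r))" by blast
  have "summable f"
  proof (rule summableI_nonneg_bounded)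
    fix N
    have "N \<le> N * L" using L by simp
    then have "(\<Sum>n<N. f n) \<le> (\<Sum>n<N * L. f n)" using f0 by (intro sum_mono2) auto
    also have "\<dots> = (\<Sum>r<L. \<Sum>j<N. f (j * L + r))" unfolding sum_blocks by (rule sum.swap)
    also have "\<dots> \<le> (\<Sum>r<L. \<Sum>j. f (j * L + r))"
      using sm f0 by (intro sum_mono sum_le_suminf) auto
    finally show "(\<Sum>n<N. f n) \<le> (\<Sum>r<L. \<Sum>j. f (j * L + r))" .
  qed (rule f0)
  with f show False by blast
qed

text \<open>
  A vector orthogonal to the line through $0$ on which the quotient of real and imaginary part is the given one.
\<close>
fun ratio_normal :: "proj_real \<Rightarrow> complex" where
  "ratio_normal (Finite t) = Complex 1 (- t)"
| "ratio_normal Infty = Complex 0 1"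

lemma ratio_normal_independent:
  assumes "s \<noteq> t"
  shows "Re (ratio_normal s) * Im (ratio_normal t) - Im (ratio_normal s) * Re (ratio_normal t) \<noteq> 0"
  using assms by (cases s; cases t) auto

lemma eventually_near_ratio:
  assumes lim: "proj_tendsto (\<lambda>k. quot (v k)) t" and \<kappa>: "\<kappa> > 0"
  shows "\<forall>\<^sub>F k in sequentially. \<bar>ratio_normal t \<bullet> v k\<bar> \<le> \<kappa> * norm (v k)"
proof (cases t)
  case (Finite u)
  have "\<forall>\<^sub>F k in sequentially. \<exists>s. quot (v k) = proj_real.Finite s \<and> \<bar>s - u\<bar> < \<kappa>"
    using lim \<kappa> Finite by simp
  then show ?thesis
  proof eventually_elim
    case (elim k)
    then obtain s where s: "quot (v k) = proj_real.Finite s" "\<bar>s - u\<bar> < \<kappa>" by blast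
    then have "Im (v k) \<noteq> 0" "s = Re (v k) / Im (v k)" by (auto simp: quot_def split: if_splits)
    then have "ratio_normal t \<bullet> v k = (s - u) * Im (v k)"
      using Finite by (simp add: inner_complex_def field_simps)
    then have "\<bar>ratio_normal t \<bullet> v k\<bar> = \<bar>s - u\<bar> * \<bar>Im (v k)\<bar>" by (simp add: abs_mult)
    also have "\<dots> \<le> \<kappa> * norm (v k)"
      using s(2) \<kappa> abs_Im_le_cmod by (intro mult_mono) auto
    finally show ?case .
  qed
next
  case Infty
  have "\<forall>\<^sub>F k in sequentially. \<forall>s. quot (v k) = proj_real.Finite s \<longrightarrow> \<bar>s\<bar> > 1 / \<kappa>"
    using lim Infty by simp
  then show ?thesis
  proof eventually_elim
    case (elim k)
    have "\<bar>Im (v k)\<bar> \<le> \<kappa> * norm (v k)"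
    proof (cases "Im (v k) = 0")
      case True
      then show ?thesis using \<kappa> by simp
    next
      case False
      then have "1 / \<kappa> < \<bar>Re (v k)\<bar> / \<bar>Im (v k)\<bar>" using elim by (simp add: quot_def)
      then have "\<bar>Im (v k)\<bar> < \<kappa> * \<bar>Re (v k)\<bar>" using \<kappa> False by (simp add: field_simps)
      also have "\<dots> \<le> \<kappa> * norm (v k)" using \<kappa> abs_Re_le_cmod by (intro mult_left_mono) auto
      finally show ?thesis by simp
    qed
    then show ?case using Infty by (simp add: inner_complex_def)
  qed
qed

lemma nonsummable_near_ratio:
  assumes "is_ratio c t" and \<kappa>: "\<kappa> > 0"
  shows "\<not> summable (\<lambda>n. if \<bar>ratio_normal t \<bullet> c n\<bar> \<le> \<kappa> * norm (c n) then norm (c n) else 0)"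
proof -
  let ?f = "\<lambda>n. if \<bar>ratio_normal t \<bullet> c n\<bar> \<le> \<kappa> * norm (c n) then norm (c n) else 0"
  obtain r where r: "strict_mono r" "\<not> summable (\<lambda>k. norm (c (r k)))" "proj_tendsto (\<lambda>k. quot (c (r k))) t"
    using assms(1) by (auto simp: is_ratio_def)
  have "\<forall>\<^sub>F k in sequentially. ?f (r k) = norm (c (r k))"
    using eventually_near_ratio[OF r(3) \<kappa>] by eventually_elim simp
  then have "\<not> summable (\<lambda>k. ?f (r k))" using r(2) by (simp only: summable_cong not_False_eq_True)
  moreover have "inj r" using r(1) strict_mono_imp_inj_on by blast
  ultimately show ?thesis by (intro nonsummable_mono_subseq[of ?f r]) auto
qed

text \<open>
  A vector that is nearly orthogonal both to \<open>\<nu>\<close> and to a unit vector \<open>g\<close> forces \<open>\<nu>\<close> and \<open>g\<close> to be nearly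
  parallel. As \<open>\<nu>\<close> and \<open>\<nu>'\<close> are independent, this cannot happen for both of them; so the terms near one of the two
  directions are seen by \<open>g\<close> with a definite proportion of their length.
\<close>
lemma independent_normals_cone:
  fixes \<nu> \<nu>' :: complex
  assumes "Re \<nu> * Im \<nu>' - Im \<nu> * Re \<nu>' \<noteq> 0"
  obtains \<kappa> where "\<kappa> > 0" "\<And>g. norm g = 1 \<Longrightarrow>
    (\<forall>v. \<bar>\<nu> \<bullet> v\<bar> \<le> \<kappa> * norm v \<longrightarrow> \<kappa> * norm v \<le> \<bar>g \<bullet> v\<bar>) \<or>
    (\<forall>v. \<bar>\<nu>' \<bullet> v\<bar> \<le> \<kappa> * norm v \<longrightarrow> \<kappa> * norm v \<le> \<bar>g \<bullet> v\<bar>)"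
proof -
  define det where "det a b = Re a * Im b - Im a * Re b" for a b :: complex
  define N where "N = norm \<nu> + norm \<nu>'"
  define D where "D = \<bar>det \<nu> \<nu>'\<bar>"
  \<comment> \<open>Two failures would give \<open>D \<le> N * (1 + N) * \<kappa>\<close>; this choice makes the right-hand side \<open>D / 2\<close>.\<close>
  define \<kappa> where "\<kappa> = D / (2 * (N * (1 + N)))"
  have "D > 0" using assms by (simp add: D_def det_def)
  have "\<nu> \<noteq> 0" using assms by auto
  then have "N > 0" unfolding N_def by (simp add: add_pos_nonneg)
  then have \<kappa>: "\<kappa> > 0" using \<open>D > 0\<close> by (simp add: \<kappa>_def)
  have small_det: "\<bar>det g n\<bar> \<le> \<kappa> * (1 + N)"
    if g: "norm g = 1" and n: "norm n \<le> N" and v: "\<bar>n \<bullet> v\<bar> \<le> \<kappa> * norm v" "\<bar>g \<bullet> v\<bar> < \<kappa> * norm v" for g n v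
  proof -
    have "v \<noteq> 0" using v(2) by auto
    then have vpos: "norm v > 0" by simp
    \<comment> \<open>The vectors \<open>v\<close> and \<open>v'\<close> form an orthogonal frame of equal lengths, in which the determinant is computed.\<close>
    define v' where "v' = \<i> * v"
    have v': "norm v' = norm v" by (simp add: v'_def norm_mult)
    have "(norm v)\<^sup>2 = (Re v)\<^sup>2 + (Im v)\<^sup>2" by (simp add: cmod_power2)
    then have "det g n * (norm v)\<^sup>2 = (g \<bullet> v) * (n \<bullet> v') - (g \<bullet> v') * (n \<bullet> v)"
      by (simp only: det_def v'_def inner_complex_def) (simp add: algebra_simps power2_eq_square)
    moreover have "\<bar>det g n\<bar> * (norm v)\<^sup>2 = \<bar>det g n * (norm v)\<^sup>2\<bar>" by (simp add: abs_mult)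
    ultimately have "\<bar>det g n\<bar> * (norm v)\<^sup>2 = \<bar>(g \<bullet> v) * (n \<bullet> v') - (g \<bullet> v') * (n \<bullet> v)\<bar>"
      by simp
    also have "\<dots> \<le> \<bar>g \<bullet> v\<bar> * \<bar>n \<bullet> v'\<bar> + \<bar>g \<bullet> v'\<bar> * \<bar>n \<bullet> v\<bar>"
      by (intro order_trans[OF abs_triangle_ineq4]) (simp add: abs_mult)
    also have "\<dots> \<le> (\<kappa> * norm v) * (N * norm v) + (1 * norm v) * (\<kappa> * norm v)"
    proof (intro add_mono mult_mono)
      show "\<bar>n \<bullet> v'\<bar> \<le> N * norm v"
        using Cauchy_Schwarz_ineq2[of n v'] mult_right_mono[OF n, of "norm v"] v' by simp
      show "\<bar>g \<bullet> v'\<bar> \<le> 1 * norm v"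
        using Cauchy_Schwarz_ineq2[of g v'] g v' by simp
    qed (use v \<kappa> in auto)
    also have "\<dots> = \<kappa> * (1 + N) * (norm v)\<^sup>2" by (simp add: algebra_simps power2_eq_square)
    finally show ?thesis using vpos by simp
  qed
  show thesis
  proof (rule that[OF \<kappa>], rule ccontr)
    fix g :: complex
    assume g: "norm g = 1" and not: "\<not> ((\<forall>v. \<bar>\<nu> \<bullet> v\<bar> \<le> \<kappa> * norm v \<longrightarrow> \<kappa> * norm v \<le> \<bar>g \<bullet> v\<bar>) \<or>
      (\<forall>v. \<bar>\<nu>' \<bullet> v\<bar> \<le> \<kappa> * norm v \<longrightarrow> \<kappa> * norm v \<le> \<bar>g \<bullet> v\<bar>))"
    have b: "\<bar>det g \<nu>\<bar> \<le> \<kappa> * (1 + N)" "\<bar>det g \<nu>'\<bar> \<le> \<kappa> * (1 + N)"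
      using not small_det[OF g, of \<nu>] small_det[OF g, of \<nu>'] by (auto simp: N_def not_le)
    have "(Re g)\<^sup>2 + (Im g)\<^sup>2 = 1" using g by (simp flip: cmod_power2)
    moreover have "(\<nu> \<bullet> g) * det g \<nu>' - (\<nu>' \<bullet> g) * det g \<nu> = det \<nu> \<nu>' * ((Re g)\<^sup>2 + (Im g)\<^sup>2)"
      unfolding det_def inner_complex_def by (simp add: algebra_simps power2_eq_square)
    ultimately have "D = \<bar>(\<nu> \<bullet> g) * det g \<nu>' - (\<nu>' \<bullet> g) * det g \<nu>\<bar>" by (simp add: D_def)
    also have "\<dots> \<le> \<bar>\<nu> \<bullet> g\<bar> * \<bar>det g \<nu>'\<bar> + \<bar>\<nu>' \<bullet> g\<bar> * \<bar>det g \<nu>\<bar>"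
      by (intro order_trans[OF abs_triangle_ineq4]) (simp add: abs_mult)
    also have "\<dots> \<le> norm \<nu> * (\<kappa> * (1 + N)) + norm \<nu>' * (\<kappa> * (1 + N))"
      using b g Cauchy_Schwarz_ineq2[of \<nu> g] Cauchy_Schwarz_ineq2[of \<nu>' g]
      by (intro add_mono mult_mono) auto
    also have "\<dots> = N * (1 + N) * \<kappa>" by (simp add: N_def algebra_simps)
    also have "\<dots> = D / 2"
    proof -
      have "M * (D / (2 * M)) = D / 2" if "M \<noteq> 0" for M using that by simp
      moreover have "N * (1 + N) \<noteq> 0" using \<open>N > 0\<close> by simp
      ultimately show ?thesis unfolding \<kappa>_def by blast
    qed
    finally show False using \<open>D > 0\<close> by simp
  qed
qed

text \<open>
  Along each residue class \<open>r\<close> modulo \<open>L\<close>, the functionals with summable values form a linear subspace \<open>V r\<close>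
  of the plane, and the intersection of all of them is trivial. Two classes already suffice: take \<open>r\<close> with \<open>V r\<close> at most a
  line, and if it is a line, a class \<open>r'\<close> whose subspace does not contain that line.
\<close>
lemma linearly_nonsummable_residue_classes:
  assumes c: "linearly_nonsummable c" and L: "L > 0"
  shows "\<exists>r<L. \<exists>r'<L. \<forall>g. norm g = 1 \<longrightarrow>
    \<not> summable (\<lambda>j. \<bar>g \<bullet> c (j * L + r)\<bar>) \<or> \<not> summable (\<lambda>j. \<bar>g \<bullet> c (j * L + r')\<bar>)"
proof -
  define V where "V r = {g. summable (\<lambda>j. \<bar>g \<bullet> c (j * L + r)\<bar>)}" for r
  have V_comb: "a *\<^sub>R g + b *\<^sub>R h \<in> V r" if "g \<in> V r" "h \<in> V r" for a b g h r
  proof -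
    have "summable (\<lambda>j. \<bar>a\<bar> * \<bar>g \<bullet> c (j * L + r)\<bar> + \<bar>b\<bar> * \<bar>h \<bullet> c (j * L + r)\<bar>)"
      using that by (intro summable_add summable_mult) (auto simp: V_def)
    then have "summable (\<lambda>j. \<bar>(a *\<^sub>R g + b *\<^sub>R h) \<bullet> c (j * L + r)\<bar>)"
    proof (rule summable_comparison_test')
      fix j
      show "norm \<bar>(a *\<^sub>R g + b *\<^sub>R h) \<bullet> c (j * L + r)\<bar> \<le> \<bar>a\<bar> * \<bar>g \<bullet> c (j * L + r)\<bar> + \<bar>b\<bar> * \<bar>h \<bullet> c (j * L + r)\<bar>"
        using abs_triangle_ineq[of "a * (g \<bullet> c (j * L + r))" "b * (h \<bullet> c (j * L + r))"]
        by (simp add: inner_add_left abs_mult)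
    qed
    then show ?thesis by (simp add: V_def)
  qed
  have V_scale: "a *\<^sub>R g \<in> V r" if "g \<in> V r" for a g r using V_comb[OF that that, of a 0] by simp
  have escape: "\<exists>r<L. g \<notin> V r" if "g \<noteq> 0" for g
  proof -
    have "\<not> summable (\<lambda>n. \<bar>g \<bullet> c n\<bar>)"
      using c that unfolding linearly_nonsummable_def inner_complex_def by (metis complex.collapse)
    then show ?thesis
      using nonsummable_residue_class[of "\<lambda>n. \<bar>g \<bullet> c n\<bar>" L] L unfolding V_def
      by (metis abs_ge_zero mem_Collect_eq)
  qed
  obtain r where r: "r < L" "1 \<notin> V r" using escape[of 1] by auto
  have "\<exists>r'<L. \<forall>g. g \<noteq> 0 \<longrightarrow> g \<notin> V r \<or> g \<notin> V r'"
  proof (cases "\<exists>g1. g1 \<noteq> 0 \<and> g1 \<in> V r")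
    case False
    then show ?thesis using r(1) by blast
  next
    case True
    then obtain g1 where g1: "g1 \<noteq> 0" "g1 \<in> V r" by blast
    obtain r' where r': "r' < L" "g1 \<notin> V r'" using escape[OF g1(1)] by blast
    have "g \<notin> V r \<or> g \<notin> V r'" if "g \<noteq> 0" for g
    proof (rule ccontr)
      assume "\<not> (g \<notin> V r \<or> g \<notin> V r')"
      then have g: "g \<in> V r" "g \<in> V r'" by auto
      obtain a b d where abd: "(a, b, d) \<noteq> (0, 0, 0)" "a *\<^sub>R g + b *\<^sub>R g1 + d *\<^sub>R 1 = 0"
        by (rule complex_linear_dependence)
      show False
      proof (cases "d = 0")
        case False
        have "d *\<^sub>R (1::complex) = (- a) *\<^sub>R g + (- b) *\<^sub>R g1"
          using abd(2) by (simp add: eq_neg_iff_add_eq_0 algebra_simps)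
        then have "(1 / d) *\<^sub>R (d *\<^sub>R (1::complex)) \<in> V r"
          using V_scale[OF V_comb[OF g(1) g1(2), of "- a" "- b"], of "1 / d"] by simp
        then show False using r(2) False by simp
      next
        case True
        then have b: "b \<noteq> 0" using abd \<open>g \<noteq> 0\<close> by auto
        have "b *\<^sub>R g1 = (- a) *\<^sub>R g"
          using abd(2) True by (simp add: eq_neg_iff_add_eq_0 add.commute)
        then have "(1 / b) *\<^sub>R (b *\<^sub>R g1) \<in> V r'"
          using V_scale[OF V_scale[OF g(2), of "- a"], of "1 / b"] by simp
        then show False using r'(2) b by simp
      qed
    qed
    then show ?thesis using r'(1) by blast
  qed
  then obtain r' where r': "r' < L" "\<And>g. g \<noteq> 0 \<Longrightarrow> g \<notin> V r \<or> g \<notin> V r'" by blast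
  have "\<not> summable (\<lambda>j. \<bar>g \<bullet> c (j * L + r)\<bar>) \<or> \<not> summable (\<lambda>j. \<bar>g \<bullet> c (j * L + r')\<bar>)" if "norm g = 1" for g
  proof -
    have "g \<noteq> 0" using that by auto
    with r'(2) show ?thesis by (simp add: V_def)
  qed
  then show ?thesis using r(1) r'(1) by blast
qed

theorem theorem1p4:
  fixes c :: "nat \<Rightarrow> complex"
  assumes "c \<longlonglongrightarrow> 0"
    and "\<not> summable (\<lambda>n. norm (c n))"
  shows "((\<exists>s t. s \<noteq> t \<and> is_ratio c s \<and> is_ratio c t) \<longrightarrow>
            (\<forall>w::complex.
               hausdorff_dim {x \<in> {0..<1::real}. (\<lambda>n. c n * of_real (R (2 ^ n * x))) sums w} = 1)) \<and>
         (linearly_nonsummable c \<and> (\<exists>!t. is_ratio c t) \<longrightarrow>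
            (\<forall>(w::complex) (\<delta>::real). \<delta> > 0 \<longrightarrow>
               hausdorff_dim {x \<in> {0..<1::real}.
                 \<exists>z \<in> ball w \<delta>. (\<lambda>n. c n * of_real (R (2 ^ n * x))) sums z} = 1))"
proof (intro conjI impI allI)
  fix w :: complex
  assume "\<exists>s t. s \<noteq> t \<and> is_ratio c s \<and> is_ratio c t"
  then obtain s t where st: "s \<noteq> t" "is_ratio c s" "is_ratio c t" by blast
  obtain \<kappa> where \<kappa>: "\<kappa> > 0" and cone: "\<And>g. norm g = 1 \<Longrightarrow>
      (\<forall>v. \<bar>ratio_normal s \<bullet> v\<bar> \<le> \<kappa> * norm v \<longrightarrow> \<kappa> * norm v \<le> \<bar>g \<bullet> v\<bar>) \<or>
      (\<forall>v. \<bar>ratio_normal t \<bullet> v\<bar> \<le> \<kappa> * norm v \<longrightarrow> \<kappa> * norm v \<le> \<bar>g \<bullet> v\<bar>)"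
    using independent_normals_cone[OF ratio_normal_independent[OF st(1)]] by blast
  define H where "H g v = (if \<kappa> * norm v \<le> \<bar>g \<bullet> v\<bar> then norm v else 0)" for g v :: complex
  define near where "near u v = (if \<bar>ratio_normal u \<bullet> v\<bar> \<le> \<kappa> * norm v then norm v else 0)" for u v
  have "hausdorff_dim {x \<in> {0..<1::real}. \<exists>z\<in>{w}. (\<lambda>n. c n * of_real (R (2 ^ n * x))) sums z} = 1"
  proof (rule hausdorff_dim_sign_series[OF assms(1), of H])
    show "0 \<le> H g v" for g v by (simp add: H_def)
  next
    fix L :: nat assume "L \<ge> 5"
    then have L: "L > 0" by simp
    have res: "\<exists>r<L. \<not> summable (\<lambda>j. near u (c (j * L + r)))" if "is_ratio c u" for u
    proof -
      have "\<not> summable (\<lambda>n. near u (c n))" "\<And>n. 0 \<le> near u (c n)"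
        using nonsummable_near_ratio[OF that \<kappa>] by (simp_all add: near_def)
      then show ?thesis using nonsummable_residue_class[of "\<lambda>n. near u (c n)" L] L by metis
    qed
    obtain r where r: "r < L" "\<not> summable (\<lambda>j. near s (c (j * L + r)))" using res[OF st(2)] by blast
    obtain r' where r': "r' < L" "\<not> summable (\<lambda>j. near t (c (j * L + r')))" using res[OF st(3)] by blast
    have transfer: "\<not> summable (\<lambda>j. H g (c (j * L + \<rho>)))"
      if "\<not> summable (\<lambda>j. near u (c (j * L + \<rho>)))"
        and "\<forall>v. \<bar>ratio_normal u \<bullet> v\<bar> \<le> \<kappa> * norm v \<longrightarrow> \<kappa> * norm v \<le> \<bar>g \<bullet> v\<bar>" for g u \<rho>
    proof
      assume "summable (\<lambda>j. H g (c (j * L + \<rho>)))"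
      then have "summable (\<lambda>j. near u (c (j * L + \<rho>)))"
        by (rule summable_comparison_test'[where N = 0]) (use that(2) in \<open>simp add: near_def H_def\<close>)
      with that(1) show False by blast
    qed
    have "\<not> summable (\<lambda>j. H g (c (j * L + r))) \<or> \<not> summable (\<lambda>j. H g (c (j * L + r')))"
      if g: "norm g = 1" for g
      using cone[OF g] transfer[OF r(2)] transfer[OF r'(2)] by metis
    then show "\<exists>r<L. \<exists>r'<L. \<forall>g. norm g = 1 \<longrightarrow>
        \<not> summable (\<lambda>j. H g (c (j * L + r))) \<or> \<not> summable (\<lambda>j. H g (c (j * L + r')))"
      using r(1) r'(1) by blast
  next
    fix z :: "nat \<Rightarrow> complex"
    assume z0: "z \<longlonglongrightarrow> 0" and z: "\<And>g. norm g = 1 \<Longrightarrow> \<not> summable (\<lambda>n. H g (z n))"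
    obtain \<epsilon> where "sign_seq \<epsilon>" "(\<lambda>n. \<epsilon> n *\<^sub>R z n) sums w"
      by (rule exact_sign_sum[OF z0 \<kappa> z[unfolded H_def]])
    then show "\<exists>\<epsilon> w'. sign_seq \<epsilon> \<and> w' \<in> {w} \<and> (\<lambda>n. \<epsilon> n *\<^sub>R z n) sums w'" by blast
  qed
  then show "hausdorff_dim {x \<in> {0..<1::real}. (\<lambda>n. c n * of_real (R (2 ^ n * x))) sums w} = 1" by simp
next
  fix w :: complex and \<delta> :: real
  assume c: "linearly_nonsummable c \<and> (\<exists>!t. is_ratio c t)" and \<delta>: "\<delta> > 0"
  show "hausdorff_dim {x \<in> {0..<1::real}. \<exists>z \<in> ball w \<delta>. (\<lambda>n. c n * of_real (R (2 ^ n * x))) sums z} = 1"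
  proof (rule hausdorff_dim_sign_series[OF assms(1), of "\<lambda>g v. \<bar>g \<bullet> v\<bar>"])
    fix L :: nat assume "L \<ge> 5"
    then show "\<exists>r<L. \<exists>r'<L. \<forall>g. norm g = 1 \<longrightarrow>
      \<not> summable (\<lambda>j. \<bar>g \<bullet> c (j * L + r)\<bar>) \<or> \<not> summable (\<lambda>j. \<bar>g \<bullet> c (j * L + r')\<bar>)"
      using c by (intro linearly_nonsummable_residue_classes) auto
  next
    fix z :: "nat \<Rightarrow> complex"
    assume "z \<longlonglongrightarrow> 0" and "\<And>g. norm g = 1 \<Longrightarrow> \<not> summable (\<lambda>n. \<bar>g \<bullet> z n\<bar>)"
    then obtain \<epsilon> l where "sign_seq \<epsilon>" "(\<lambda>n. \<epsilon> n *\<^sub>R z n) sums l" "l \<in> ball w \<delta>"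
      by (rule dense_sign_sums[OF _ \<delta>])
    then show "\<exists>\<epsilon> l. sign_seq \<epsilon> \<and> l \<in> ball w \<delta> \<and> (\<lambda>n. \<epsilon> n *\<^sub>R z n) sums l" by blast
  qed simp
qed

end
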